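(* For every $\delta>0$ there is $n_0$ such that for every $n\ge n_0$ the following holds. If $G$ is a spanning subgraph of the complete bipartite graph $K_{n,n}$ with minimum degree at least $\left(\frac{13}{16}+\delta\right)n$, then $\mathrm{tp}_2(G)\le 3$.
   Context: A $2$-colouring of a graph $G$ is an arbitrary colouring of the edges of $G$ with up to $2$ colours. A monochromatic tree is a subgraph of $G$ that is a tree all of whose edges have the same colour (a single vertex counts as a monochromatic tree). $\mathrm{tp}_2(G)$ is the smallest integer $k$ such that, in every $2$-colouring of $G$, the vertex set $V(G)$ can be partitioned into the vertex sets of at most $k$ monochromatic trees (pairwise vertex-disjoint; different trees may have different colours). *)

theory Defs
  imports Complex_Main "HOL-Library.Disjoint_Sets" "Graph_Theory.Graph_Theory"
begin

text \<open>
  Following the graph library, a finite simple graph is a symmetric digraph: the undirected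
  edge \<open>{u, v}\<close> is the pair of opposite arcs between \<open>u\<close> and \<open>v\<close>. Hence the degree of a
  vertex is its out-degree, and an edge colouring is a function of the unordered pair of end
  points, so that opposite arcs get the same colour.
\<close>

definition arc_edge :: "('a,'b) pre_digraph \<Rightarrow> 'b \<Rightarrow> 'a set" where
  "arc_edge G e = {tail G e, head G e}"

definition edges :: "('a,'b) pre_digraph \<Rightarrow> 'a set set" where
  "edges G = arc_edge G ` arcs G"

definition min_degree :: "('a,'b) pre_digraph \<Rightarrow> nat" where
  "min_degree G = Min (out_degree G ` verts G)"

text \<open>
  The library's \<^const>\<open>tree\<close> forbids directed cycles only. It fails for every symmetric digraph
  with an edge, since an arc followed by its reverse is a \<^const>\<open>pre_digraph.cycle\<close> of length 2.
  In a \<^const>\<open>graph\<close>, which has neither loops nor parallel arcs, the cycles of length at least 3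
  are exactly the cycles of the underlying undirected graph.
\<close>

definition undirected_tree :: "('a,'b) pre_digraph \<Rightarrow> bool" where
  "undirected_tree T \<longleftrightarrow>
     graph T \<and> connected T \<and> \<not> (\<exists>p. pre_digraph.cycle T p \<and> 3 \<le> length p)"

text \<open>Not all \<open>r\<close> colours need to be used, and the colouring need not be proper.\<close>

definition edge_colouring :: "nat \<Rightarrow> ('a,'b) pre_digraph \<Rightarrow> ('a set \<Rightarrow> nat) \<Rightarrow> bool" where
  "edge_colouring r G c \<longleftrightarrow> c ` edges G \<subseteq> {..<r}"

definition monochromatic_tree ::
    "('a,'b) pre_digraph \<Rightarrow> ('a set \<Rightarrow> nat) \<Rightarrow> ('a,'b) pre_digraph \<Rightarrow> bool" where
  "monochromatic_tree G c T \<longleftrightarrow>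
     subgraph T G \<and> undirected_tree T \<and> (\<exists>i. \<forall>e\<in>edges T. c e = i)"

definition mono_tree_partition ::
    "('a,'b) pre_digraph \<Rightarrow> ('a set \<Rightarrow> nat) \<Rightarrow> 'a set set \<Rightarrow> bool" where
  "mono_tree_partition G c P \<longleftrightarrow>
     partition_on (verts G) P \<and> (\<forall>X\<in>P. \<exists>T. monochromatic_tree G c T \<and> verts T = X)"

definition tp :: "nat \<Rightarrow> ('a,'b) pre_digraph \<Rightarrow> nat" where
  "tp r G = (LEAST k. \<forall>c. edge_colouring r G c \<longrightarrow>
     (\<exists>P. mono_tree_partition G c P \<and> finite P \<and> card P \<le> k))"

text \<open>
  For a finite graph the set of admissible \<open>k\<close> is not empty, because single vertices are
  monochromatic trees; so \<^const>\<open>tp\<close> is a genuine minimum.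
\<close>

lemma single_vertex_monochromatic_tree:
  assumes "graph G" and "v \<in> verts G"
  shows "monochromatic_tree G c \<lparr>verts = {v}, arcs = {}, tail = tail G, head = head G\<rparr>"
    (is "monochromatic_tree G c ?T")
proof -
  interpret graph G by fact
  have T: "graph ?T"
    by unfold_locales (auto simp: symmetric_def arcs_ends_def sym_def)
  have wf: "wf_digraph ?T"
    by unfold_locales auto
  have "subgraph ?T G"
    using assms(2) wf wf_digraph by (auto simp: subgraph_def compatible_def)
  moreover have "connected ?T"
    by (auto simp: connected_def strongly_connected_def mk_symmetric_def reachable_def
        intro: rtrancl_on_refl)
  moreover have "\<not> pre_digraph.cycle ?T p" for p
    by (cases p) (auto simp: pre_digraph.cycle_def pre_digraph.awalk_def)
  ultimately show ?thesis
    using T by (auto simp: monochromatic_tree_def undirected_tree_def edges_def)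
qed

lemma tp_le_iff:
  assumes "graph G"
  shows "tp r G \<le> k \<longleftrightarrow> (\<forall>c. edge_colouring r G c \<longrightarrow>
     (\<exists>P. mono_tree_partition G c P \<and> finite P \<and> card P \<le> k))" (is "_ \<longleftrightarrow> ?A k")
proof
  interpret graph G by fact
  let ?P = "(\<lambda>v. {v}) ` verts G"
  have "mono_tree_partition G c ?P" for c
  proof -
    have "\<exists>T. monochromatic_tree G c T \<and> verts T = {v}" if "v \<in> verts G" for v
      using single_vertex_monochromatic_tree[OF assms that, of c] by fastforce
    moreover have "partition_on (verts G) ?P"
      by (auto simp: partition_on_def disjoint_def)
    ultimately show ?thesis
      by (auto simp: mono_tree_partition_def)
  qed
  moreover have "finite ?P" "card ?P \<le> card (verts G)"
    by (auto intro: card_image_le)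
  ultimately have "?A (card (verts G))" by blast
  then have least: "?A (tp r G)"
    unfolding tp_def by (rule LeastI)
  assume "tp r G \<le> k"
  then show "?A k" using least by (meson order_trans)
next
  assume "?A k"
  then show "tp r G \<le> k" unfolding tp_def by (rule Least_le)
qed

end

(*
  Let x and y be vertices with red component X of x disjoint from blue component Y of y. On the
  common neighbourhood Q of x and y (if they lie on the same side) all edges at x are blue and all
  edges at y are red, so x and y are the centres of a blue and a red star on Q. Splitting the
  vertices into three random classes, the first class supplies a red tree around y, the second a
  blue tree around x, and the third is reserved. Every vertex with linearly many neighbours of a
  suitable colour attaches to one of the two trees, whatever the split. The exceptional vertices
  have almost all their remaining edges in one colour, so that any two of them have linearly many
  common neighbours in that colour, and they form a third tree through the reserved class.
  If x and y lie on opposite sides and the previous case does not occur, then x has only blue and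
  y only red edges, and the argument is similar.
  If every red component meets every blue one and there are at least four of each, then some four
  vertices lie pairwise in different components of both colours, which the degrees exclude.
*)
theory Submission
  imports Defs "HOL-Real_Asymp.Real_Asymp" "HOL-Library.FuncSet"
begin

section \<open>Sets spanned by a tree\<close>

text \<open>For symmetric \<open>R\<close> the grown sets are the finite nonempty sets on which
  \<open>R\<close> induces a connected graph. The leaf-by-leaf encoding suits both the attaching
  arguments and the final construction of a tree.\<close>

inductive grown :: "('v \<Rightarrow> 'v \<Rightarrow> bool) \<Rightarrow> 'v set \<Rightarrow> bool" for R where
  single: "grown R {v}"
| leaf: "grown R S \<Longrightarrow> u \<in> S \<Longrightarrow> v \<notin> S \<Longrightarrow> R u v \<Longrightarrow> grown R (insert v S)"

text \<open>All vertices of \<open>X\<close> become leaves hanging from \<open>S\<close> itself, so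
  their order is immaterial. Vertices already in \<open>S\<close> are allowed, so overlaps need no
  care.\<close>

lemma grown_attach:
  assumes "grown R S" "finite X" "symp R" "\<And>v. v \<in> X \<Longrightarrow> v \<in> S \<or> (\<exists>u\<in>S. R v u)"
  shows "grown R (S \<union> X)"
  using assms(2,4)
proof (induction X)
  case empty
  then show ?case using assms(1) by simp
next
  case (insert v X)
  then have IH: "grown R (S \<union> X)" by blast
  show ?case
  proof (cases "v \<in> S")
    case True
    then have "S \<union> insert v X = S \<union> X" by blast
    then show ?thesis using IH by simp
  next
    case False
    then obtain u where u: "u \<in> S" "R v u" using insert.prems by blast
    then have "R u v" using assms(3) by (simp add: sympD)
    then have "grown R (insert v (S \<union> X))"
      using IH False insert.hyps u by (intro grown.leaf[where u=u]) auto
    then show ?thesis by simp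
  qed
qed

text \<open>A largest grown subset of the component that contains \<open>v\<close> has no edge
  leaving it, since the far end could be added as a leaf; hence it is the whole component.\<close>

lemma grown_reachable:
  assumes "finite {w. R\<^sup>*\<^sup>* v w}"
  shows "grown R {w. R\<^sup>*\<^sup>* v w}"
proof -
  let ?C = "{w. R\<^sup>*\<^sup>* v w}"
  have "\<exists>S. (grown R S \<and> v \<in> S \<and> S \<subseteq> ?C) \<and>
      (\<forall>T. grown R T \<and> v \<in> T \<and> T \<subseteq> ?C \<longrightarrow> card T \<le> card S)"
    by (rule ex_has_greatest_nat[where k="{v}" and b="Suc (card ?C)"])
      (auto simp: grown.single less_Suc_eq_le intro: card_mono assms)
  then obtain S where S: "grown R S" "v \<in> S" "S \<subseteq> ?C"
    and max: "\<And>T. grown R T \<Longrightarrow> v \<in> T \<Longrightarrow> T \<subseteq> ?C \<Longrightarrow> card T \<le> card S" by blast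
  have closed: "b \<in> S" if "a \<in> S" "R a b" for a b
  proof (rule ccontr)
    assume "b \<notin> S"
    then have "grown R (insert b S)" using grown.leaf S(1) that by metis
    moreover have "insert b S \<subseteq> ?C" using S(3) that by (auto intro: rtranclp.rtrancl_into_rtrancl)
    ultimately have "card (insert b S) \<le> card S" using max S(2) by blast
    moreover have "finite S" using S(3) assms finite_subset by blast
    ultimately show False using \<open>b \<notin> S\<close> by simp
  qed
  have "w \<in> S" if "R\<^sup>*\<^sup>* v w" for w
    using that by (induction rule: rtranclp_induct) (use S(2) closed in auto)
  then have "S = ?C" using S(3) by blast
  then show ?thesis using S(1) by simp
qed

definition three_parts :: "'v set \<Rightarrow> ('v \<Rightarrow> 'v \<Rightarrow> bool) \<Rightarrow> ('v \<Rightarrow> 'v \<Rightarrow> bool) \<Rightarrow> bool" where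
  "three_parts V R B \<longleftrightarrow>
    (\<exists>P. partition_on V P \<and> finite P \<and> card P \<le> 3 \<and> (\<forall>X\<in>P. grown R X \<or> grown B X))"

lemma three_parts_commute: "three_parts V R B = three_parts V B R"
  unfolding three_parts_def by (simp add: disj_commute)

text \<open>Every vertex outside the three cores becomes a leaf of the red core if it can, and of
  the blue core otherwise. The third core stays as it is.\<close>

lemma three_parts_by_attaching:
  assumes "finite V" "symp R" "symp B" "grown R C" "grown B D" "T = {} \<or> grown R T \<or> grown B T"
    and sub: "C \<subseteq> V" "D \<subseteq> V" "T \<subseteq> V"
    and disj: "C \<inter> D = {}" "C \<inter> T = {}" "D \<inter> T = {}"
    and rest: "\<And>v. v \<in> V \<Longrightarrow> v \<notin> C \<Longrightarrow> v \<notin> D \<Longrightarrow> v \<notin> T \<Longrightarrow> (\<exists>u\<in>C. R v u) \<or> (\<exists>u\<in>D. B v u)"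
  shows "three_parts V R B"
proof -
  define Z where "Z = V - (C \<union> D \<union> T)"
  define X where "X = {v\<in>Z. \<exists>u\<in>C. R v u}"
  have Y: "\<exists>u\<in>D. B v u" if "v \<in> Z - X" for v
    using that rest[of v] unfolding X_def Z_def by blast
  have fin: "finite X" "finite (Z - X)" using assms(1) unfolding X_def Z_def by auto
  have gC: "grown R (C \<union> X)"
    by (rule grown_attach) (use assms fin in \<open>auto simp: X_def\<close>)
  have gD: "grown B (D \<union> (Z - X))"
    by (rule grown_attach) (use assms fin Y in auto)
  \<comment> \<open>A partition has no empty member, so the empty set is dropped in case
    \<open>T\<close> is empty.\<close>
  define P where "P = {C \<union> X, D \<union> (Z - X), T} - {{}}"
  have XZ: "X \<subseteq> Z" by (auto simp: X_def)
  have "partition_on V P"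
  proof (rule partition_onI)
    have "\<Union>P = \<Union>{C \<union> X, D \<union> (Z - X), T}" unfolding P_def by blast
    also have "\<dots> = C \<union> D \<union> T \<union> Z" using XZ by auto
    finally show "\<Union>P = V" using sub by (auto simp: Z_def)
    have "disjnt (C \<union> X) (D \<union> (Z - X))" "disjnt (C \<union> X) T" "disjnt (D \<union> (Z - X)) T"
      using disj XZ unfolding disjnt_def Z_def by blast+
    then show "disjnt p q" if "p \<in> P" "q \<in> P" "p \<noteq> q" for p q
      using that unfolding P_def by (auto simp only: Diff_iff insert_iff empty_iff disjnt_sym)
  qed (simp add: P_def)
  moreover have "finite P" unfolding P_def by simp
  moreover have "card P \<le> card {C \<union> X, D \<union> (Z - X), T}"
    unfolding P_def by (rule card_mono) auto
  moreover have "card {C \<union> X, D \<union> (Z - X), T} \<le> 3"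
    by (simp add: card_insert_if)
  moreover have "\<forall>X\<in>P. grown R X \<or> grown B X"
    using gC gD assms(6) unfolding P_def by blast
  ultimately show ?thesis unfolding three_parts_def by (intro exI[of _ P]) linarith
qed

text \<open>A proportion of at most \<open>3 * (2/3)^m\<close> of all maps into three classes misses a class on a
  given set of size \<open>m\<close>.\<close>

lemma exists_three_splitting:
  fixes V :: "'v set"
  assumes "finite V" "finite F" and F: "\<And>A. A \<in> F \<Longrightarrow> A \<subseteq> V \<and> m \<le> card A"
    and large: "3 * card F * 2 ^ m < (3::nat) ^ m"
  shows "\<exists>f. \<forall>A\<in>F. \<forall>i<3::nat. \<exists>a\<in>A. f a = i"
proof -
  define All where "All = (\<Pi>\<^sub>E v\<in>V. {..<3::nat})"
  define Bad where "Bad A i = {f\<in>All. \<forall>a\<in>A. f a \<noteq> i}" for A and i :: nat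
  have cAll: "card All = 3 ^ card V" unfolding All_def using assms(1) by (simp add: card_PiE)
  have finAll: "finite All" unfolding All_def using assms(1) by (auto intro: finite_PiE)
  have bad: "3 ^ m * card (Bad A i) \<le> 2 ^ m * 3 ^ card V" if "A \<in> F" "i < 3" for A i
  proof -
    have A: "A \<subseteq> V" "m \<le> card A" using F that(1) by auto
    \<comment> \<open>Missing class \<open>i\<close> on \<open>A\<close> restricts each vertex
      separately, so the bad maps form a product set.\<close>
    have eq: "Bad A i = (\<Pi>\<^sub>E v\<in>V. if v \<in> A then {..<3} - {i} else {..<3})"
      unfolding Bad_def All_def PiE_def Pi_def using A(1) by (auto split: if_splits)
    have "card (Bad A i) = (\<Prod>v\<in>V. card (if v \<in> A then {..<3} - {i} else {..<3}))"
      unfolding eq using assms(1) by (rule card_PiE)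
    also have "\<dots> = (\<Prod>v\<in>V. if v \<in> A then 2 else 3)"
      using that(2) by (intro prod.cong) auto
    also have "\<dots> = 2 ^ card A * 3 ^ card (V - A)"
      using assms(1) A(1) by (simp add: prod.If_cases Int_absorb1 Diff_eq)
    finally have c: "card (Bad A i) = 2 ^ card A * 3 ^ card (V - A)" .
    obtain k where k: "card A = m + k" using A(2) le_Suc_ex by blast
    have V: "card V = card A + card (V - A)"
      using A(1) assms(1) by (metis add_diff_inverse_nat card_Diff_subset card_mono finite_subset linorder_not_le)
    \<comment> \<open>The \<open>k\<close> vertices of \<open>A\<close> beyond \<open>m\<close> only
      lower the proportion further.\<close>
    have "(2::nat) ^ k \<le> 3 ^ k" by (rule power_mono) auto
    then have "3 ^ m * 2 ^ m * 3 ^ card (V - A) * 2 ^ k \<le> 3 ^ m * 2 ^ m * 3 ^ card (V - A) * (3::nat) ^ k"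
      by (rule mult_left_mono) simp
    then show ?thesis unfolding c V k by (simp add: power_add mult_ac)
  qed
  \<comment> \<open>Union bound over pairs of a set and a missed class; each pair accounts for at
    most (2/3)^m of \<open>All\<close>.\<close>
  have "All - (\<Union>(A,i)\<in>F \<times> {..<3}. Bad A i) \<noteq> {}"
  proof
    assume "All - (\<Union>(A,i)\<in>F \<times> {..<3}. Bad A i) = {}"
    then have sub: "All \<subseteq> (\<Union>(A,i)\<in>F \<times> {..<3}. Bad A i)" by blast
    have fb: "finite (Bad A i)" for A i unfolding Bad_def using finAll by auto
    have "card All \<le> card (\<Union>(A,i)\<in>F \<times> {..<3}. Bad A i)"
      by (rule card_mono[OF _ sub]) (use assms(2) fb in auto)
    also have "\<dots> \<le> (\<Sum>(A,i)\<in>F \<times> {..<3}. card (Bad A i))"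
      by (rule order.trans[OF card_UN_le]) (use assms(2) in \<open>auto simp: case_prod_beta\<close>)
    finally have "3 ^ m * card All \<le> (\<Sum>(A,i)\<in>F \<times> {..<3}. 3 ^ m * card (Bad A i))"
      by (simp add: sum_distrib_left case_prod_beta flip: sum_distrib_left)
    also have "\<dots> \<le> (\<Sum>(A,i)\<in>F \<times> {..<3::nat}. 2 ^ m * 3 ^ card V)"
      by (rule sum_mono) (use bad in auto)
    also have "\<dots> = (3 * card F * 2 ^ m) * 3 ^ card V"
      by (simp add: card_cartesian_product mult_ac)
    also have "\<dots> < 3 ^ m * 3 ^ card V" using large by simp
    finally show False unfolding cAll by simp
  qed
  then obtain f where f: "f \<in> All" "f \<notin> (\<Union>(A,i)\<in>F \<times> {..<3}. Bad A i)" by blast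
  have "\<exists>a\<in>A. f a = i" if "A \<in> F" "i < 3" for A i
    using f that unfolding Bad_def by auto
  then show ?thesis by blast
qed

section \<open>Two-coloured dense bipartite graphs\<close>

definition nb :: "('v \<Rightarrow> 'v \<Rightarrow> bool) \<Rightarrow> 'v \<Rightarrow> 'v set \<Rightarrow> 'v set" where
  "nb R u S = {v\<in>S. R u v}"

lemma nb_iff [simp]: "v \<in> nb R u S \<longleftrightarrow> v \<in> S \<and> R u v"
  by (simp add: nb_def)

lemma nb_subset [simp]: "S \<subseteq> T \<Longrightarrow> nb R u S \<subseteq> T"
  by auto

text \<open>The size \<open>m\<close> is such that a random splitting into three classes meets, in every class, each
  of \<open>8 * n\<close> given sets of at least \<open>m\<close> vertices. The thresholds below are \<open>m + 1\<close>, which leaves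
  room for deleting one vertex.\<close>

locale two_coloured_bipartite =
  fixes U W :: "'v set" and R B :: "'v \<Rightarrow> 'v \<Rightarrow> bool" and n m :: nat
  assumes finite_sides: "finite U" "finite W" and disjoint_sides: "U \<inter> W = {}"
    and card_sides: "card U = n" "card W = n"
    and sym: "symp R" "symp B"
    and bipartite: "R u v \<or> B u v \<Longrightarrow> u \<in> U \<and> v \<in> W \<or> u \<in> W \<and> v \<in> U"
    and one_colour: "\<not> (R u v \<and> B u v)"
    and missing_U: "u \<in> U \<Longrightarrow> 16 * card {w\<in>W. \<not> R u w \<and> \<not> B u w} \<le> 3 * n"
    and missing_W: "w \<in> W \<Longrightarrow> 16 * card {u\<in>U. \<not> R w u \<and> \<not> B w u} \<le> 3 * n"
    and m_small: "256 * m + 256 \<le> n"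
    and m_large: "24 * n * 2 ^ m < (3::nat) ^ m"
begin

lemma swap_sides: "two_coloured_bipartite W U R B n m"
  by unfold_locales
    (use finite_sides disjoint_sides card_sides sym bipartite one_colour missing_U missing_W
      m_small m_large in \<open>auto simp del: One_nat_def\<close>)

lemma swap_colours: "two_coloured_bipartite U W B R n m"
  by unfold_locales
    (use finite_sides disjoint_sides card_sides sym bipartite one_colour missing_U missing_W
      m_small m_large in \<open>auto simp: conj_commute simp del: One_nat_def\<close>)

lemma R_sym: "R u v \<longleftrightarrow> R v u" and B_sym: "B u v \<longleftrightarrow> B v u"
  using sym by (auto dest: sympD)

text \<open>A vertex misses at most 3n/16 of the whole opposite side, hence at most that many
  vertices of \<open>S\<close>. Counts are multiplied by 16 to stay in the natural numbers.\<close>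

lemma card_le_neighbours:
  assumes "u \<in> U" "S \<subseteq> W"
  shows "16 * card S \<le> 16 * card (nb R u S) + 16 * card (nb B u S) + 3 * n"
proof -
  let ?M = "{w\<in>W. \<not> R u w \<and> \<not> B u w}"
  have fin: "finite S" "finite ?M" using finite_sides assms(2) finite_subset by auto
  have "card S \<le> card (nb R u S \<union> nb B u S \<union> ?M)"
    by (rule card_mono) (use fin assms in \<open>auto simp: nb_def\<close>)
  also have "\<dots> \<le> card (nb R u S) + card (nb B u S) + card ?M"
    by (meson card_Un_le add_mono order_refl order_trans)
  finally show ?thesis using missing_U[OF assms(1)] by linarith
qed

lemma card_le_neighbours':
  assumes "w \<in> W" "S \<subseteq> U"
  shows "16 * card S \<le> 16 * card (nb R w S) + 16 * card (nb B w S) + 3 * n"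
proof -
  interpret s: two_coloured_bipartite W U R B n m by (rule swap_sides)
  show ?thesis using s.card_le_neighbours assms by blast
qed

text \<open>The bound \<open>8 * n\<close> turns \<open>m_large\<close> into the hypothesis of the
  union bound, as 24 = 3 * 8. Sets that are too small or outside the sides are filtered out, so a
  family may be listed before its members are checked.\<close>

lemma splitting:
  assumes "finite F" "card F \<le> 8 * n"
  obtains f where "\<And>A i. A \<in> F \<Longrightarrow> A \<subseteq> U \<union> W \<Longrightarrow> m \<le> card A \<Longrightarrow> i < (3::nat) \<Longrightarrow> \<exists>a\<in>A. f a = i"
proof -
  let ?F = "{A\<in>F. A \<subseteq> U \<union> W \<and> m \<le> card A}"
  have "card ?F \<le> 8 * n" using card_mono[of F ?F] assms by simp
  then have "3 * card ?F * 2 ^ m \<le> 24 * n * 2 ^ m" by simp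
  then have "3 * card ?F * 2 ^ m < 3 ^ m" using m_large by linarith
  then have "\<exists>f. \<forall>A\<in>?F. \<forall>i<3::nat. \<exists>a\<in>A. f a = i"
    by (intro exists_three_splitting[where V="U \<union> W"]) (use assms finite_sides in auto)
  then obtain f where "\<forall>A\<in>?F. \<forall>i<3::nat. \<exists>a\<in>A. f a = i" ..
  then show ?thesis by (intro that[of f]) auto
qed


section \<open>Three trees when the centres of the two stars lie on the same side\<close>

lemma card_Un_five:
  assumes "card A1 \<le> n" "card A2 \<le> n" "card A3 \<le> n" "card A4 \<le> n" "card A5 \<le> n"
  shows "card (A1 \<union> A2 \<union> A3 \<union> A4 \<union> A5) \<le> 8 * n"
proof -
  have "card (A1 \<union> A2 \<union> A3 \<union> A4 \<union> A5) \<le> card A1 + card A2 + card A3 + card A4 + card A5"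
    by (meson card_Un_le add_mono order_refl order_trans)
  then show ?thesis using assms by linarith
qed

lemma card_image_sides: "card (f ` U) \<le> n" "card (f ` W) \<le> n"
  using card_image_le[OF finite_sides(1), of f] card_image_le[OF finite_sides(2), of f] card_sides
  by auto

text \<open>Vertices of \<open>r\<close> join the red tree at \<open>y\<close>, and vertices of
  \<open>b\<close> the blue tree at \<open>x\<close>, through any class of \<open>Q\<close>;
  together they exhaust \<open>W\<close>. A vertex of \<open>U\<close> outside \<open>Q\<close>
  fails to join only if it is \<open>bad\<close>. Then few of its edges to \<open>W - b\<close>, a
  subset of \<open>r\<close>, are red. By \<open>le\<close> this is the larger of the two leftover
  sets, large enough for a blue third tree.\<close>

lemma three_parts_common_side_aux:
  assumes xy: "x \<in> W" "y \<in> W" and Q: "Q \<subseteq> U" "10 * n \<le> 16 * card Q"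
    and x: "\<And>q. q \<in> Q \<Longrightarrow> B x q" and y: "\<And>q. q \<in> Q \<Longrightarrow> R y q"
    and r_def: "r = {w\<in>W. m < card (nb R w Q)}" and b_def: "b = {w\<in>W. m < card (nb B w Q)}"
    and le: "card (W - r) \<le> card (W - b)"
  shows "three_parts (U \<union> W) R B"
proof -
  have fin: "finite Q" "finite r" "finite b" "finite (W - b)" "finite (W - r)"
    using finite_sides Q(1) finite_subset unfolding r_def b_def by auto
  have nbfin: "finite (nb C v S)" if "finite S" for C and v :: 'v and S
    using that by (simp add: nb_def)
  have rb: "W = r \<union> b"
  proof -
    have "w \<in> r \<or> w \<in> b" if "w \<in> W" for w
      using card_le_neighbours'[OF that Q(1)] Q(2) m_small that unfolding r_def b_def by auto
    then show ?thesis unfolding r_def b_def by auto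
  qed
  have "\<forall>q\<in>Q. \<not> R x q" "\<forall>q\<in>Q. \<not> B y q" using x y one_colour by blast+
  then have "nb R x Q = {}" "nb B y Q = {}" by auto
  then have xr: "x \<notin> r" and yb: "y \<notin> b" unfolding r_def b_def by auto
  then have xb: "x \<in> b" and yr: "y \<in> r" using xy rb by auto
  define L where "L = W - b"
  define bad where "bad = {u\<in>U - Q. card (nb R u r) \<le> m \<and> card (nb B u b) \<le> m}"
  have finbad: "finite bad" unfolding bad_def using finite_sides by auto
  have bad_blue: "16 * card L \<le> 16 * m + 16 * card (nb B u L) + 3 * n" if "u \<in> bad" for u
  proof -
    have "card (nb R u L) \<le> card (nb R u r)"
      by (rule card_mono[OF nbfin]) (use fin rb in \<open>auto simp: L_def\<close>)
    moreover have "16 * card L \<le> 16 * card (nb R u L) + 16 * card (nb B u L) + 3 * n"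
      by (rule card_le_neighbours) (use that in \<open>auto simp: L_def bad_def\<close>)
    ultimately show ?thesis using that unfolding bad_def by auto
  qed
  \<comment> \<open>A bad vertex has few edges of either colour into \<open>r \<inter> b\<close>, so
    this set has at most 3n/16 + 2m vertices. As \<open>L\<close> is the larger of
    \<open>W - b\<close> and \<open>W - r\<close>, it has at least half of the remainder.\<close>
  have L_big: "13 * n \<le> 32 * card L + 32 * m" if "u \<in> bad" for u
  proof -
    let ?I = "r \<inter> b"
    have "card (nb R u ?I) \<le> card (nb R u r)" "card (nb B u ?I) \<le> card (nb B u b)"
      by (rule card_mono[OF nbfin]; use fin in auto)+
    moreover have "16 * card ?I \<le> 16 * card (nb R u ?I) + 16 * card (nb B u ?I) + 3 * n"
      by (rule card_le_neighbours) (use that rb in \<open>auto simp: bad_def\<close>)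
    ultimately have I: "16 * card ?I \<le> 32 * m + 3 * n" using that unfolding bad_def by auto
    have "W = (W - b) \<union> (W - r) \<union> ?I" using rb by auto
    then have "n \<le> card (W - b) + card (W - r) + card ?I"
      using card_Un_le[of "(W - b) \<union> (W - r)" ?I] card_Un_le[of "W - b" "W - r"] card_sides
      by simp
    then show ?thesis using I le unfolding L_def by linarith
  qed
  \<comment> \<open>If \<open>bad\<close> is empty, \<open>u0\<close> is arbitrary and no third tree is needed.\<close>
  define u0 where "u0 = (SOME u. u \<in> bad)"
  \<comment> \<open>The centre \<open>y\<close> of the red tree lies in \<open>L\<close>, so it is
    deleted to keep the third tree away from it.\<close>
  define D where "D u = nb B u (nb B u0 L) - {y}" for u
  have D_big: "m \<le> card (D u)" if "u \<in> bad" for u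
  proof -
    have u0: "u0 \<in> bad" unfolding u0_def using that by (rule someI)
    have "card (nb R u (nb B u0 L)) \<le> card (nb R u r)"
      by (rule card_mono[OF nbfin]) (use fin rb in \<open>auto simp: L_def\<close>)
    moreover have "16 * card (nb B u0 L) \<le>
        16 * card (nb R u (nb B u0 L)) + 16 * card (nb B u (nb B u0 L)) + 3 * n"
      by (rule card_le_neighbours) (use that in \<open>auto simp: L_def bad_def\<close>)
    moreover have "card (nb R u r) \<le> m" using that by (simp add: bad_def)
    moreover have "card (nb B u (nb B u0 L)) \<le> card (D u) + 1"
      unfolding D_def using card_Diff_singleton_if[of "nb B u (nb B u0 L)" y] by auto
    ultimately have "16 * card L \<le> 32 * m + 16 * card (D u) + 16 + 6 * n"
      using bad_blue[OF u0] by linarith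
    \<comment> \<open>Up to terms in \<open>m\<close>, two bad vertices lose at most 12n/32 of
      \<open>L\<close>, which has at least 13n/32. By \<open>m_small\<close> the surplus n/32
      outweighs those terms.\<close>
    then have "n \<le> 96 * m + 32 * card (D u) + 32" using L_big[OF u0] by linarith
    then show ?thesis using m_small by linarith
  qed
  \<comment> \<open>One splitting serves all five families: class 0 is for the red tree, class 1 for
    the blue tree and class 2 for the third.\<close>
  define F where "F = (\<lambda>w. nb R w Q) ` W \<union> (\<lambda>w. nb B w Q) ` W \<union> (\<lambda>u. nb R u r) ` U
    \<union> (\<lambda>u. nb B u b) ` U \<union> D ` U"
  have "card F \<le> 8 * n" unfolding F_def by (intro card_Un_five card_image_sides)
  moreover have "finite F" unfolding F_def using finite_sides by simp
  ultimately obtain f where f: "\<And>A i. A \<in> F \<Longrightarrow> A \<subseteq> U \<union> W \<Longrightarrow> m \<le> card A \<Longrightarrow> i < (3::nat) \<Longrightarrow> \<exists>a\<in>A. f a = i"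
    using splitting by blast
  define part where "part S i = {v\<in>S. f v = i}" for S i
  have rW: "r \<subseteq> W" "b \<subseteq> W" "L \<subseteq> r" using rb by (auto simp: L_def)
  have V: "Q \<subseteq> U \<union> W" "r \<subseteq> U \<union> W" "b \<subseteq> U \<union> W" "L \<subseteq> U \<union> W"
    using rW Q(1) by blast+
  have r0: "\<exists>q\<in>part Q 0. R w q" if "w \<in> r" for w
    using f[of "nb R w Q" 0] that V rW unfolding F_def part_def r_def by force
  have b1: "\<exists>q\<in>part Q 1. B w q" if "w \<in> b" for w
    using f[of "nb B w Q" 1] that V rW unfolding F_def part_def b_def by force
  have good: "(\<exists>w\<in>part r 0. R u w) \<or> (\<exists>w\<in>part b 1. B u w)" if "u \<in> U" "u \<notin> Q" "u \<notin> bad" for u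
  proof -
    have "m \<le> card (nb R u r) \<or> m \<le> card (nb B u b)" using that by (auto simp: bad_def)
    then show ?thesis
    proof (elim disjE)
      assume "m \<le> card (nb R u r)"
      then show ?thesis using f[of "nb R u r" 0] that(1) V unfolding F_def part_def by auto
    next
      assume "m \<le> card (nb B u b)"
      then show ?thesis using f[of "nb B u b" 1] that(1) V unfolding F_def part_def by auto
    qed
  qed
  have T2: "\<exists>w\<in>nb B u0 (part L 2) - {y}. B u w" if "u \<in> bad" for u
    using f[of "D u" 2] D_big[OF that] that V unfolding F_def part_def D_def L_def bad_def by force
  define T where "T = (if bad = {} then {} else ({u0} \<union> (nb B u0 (part L 2) - {y})) \<union> bad)"
  have Tsub: "T \<subseteq> (part L 2 - {y}) \<union> bad" "bad \<subseteq> T"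
    unfolding T_def u0_def by (auto intro: someI)
  have T: "T = {} \<or> grown R T \<or> grown B T"
  proof -
    have "grown B (({u0} \<union> (nb B u0 (part L 2) - {y})) \<union> bad)"
    proof (intro grown_attach[OF grown_attach[OF grown.single]])
      show "finite (nb B u0 (part L 2) - {y})"
        using fin by (auto simp: nb_def part_def L_def)
      show "v \<in> {u0} \<or> (\<exists>u\<in>{u0}. B v u)" if "v \<in> nb B u0 (part L 2) - {y}" for v
        using that B_sym by auto
      show "v \<in> {u0} \<union> (nb B u0 (part L 2) - {y})
        \<or> (\<exists>u\<in>{u0} \<union> (nb B u0 (part L 2) - {y}). B v u)" if "v \<in> bad" for v
        using T2[OF that] by blast
    qed (use finbad sym in auto)
    then show ?thesis by (simp add: T_def)
  qed
  show ?thesis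
  proof (rule three_parts_by_attaching[OF _ sym _ _ T])
    show "grown R ({y} \<union> part Q 0 \<union> part r 0)"
      by (intro grown_attach[OF grown_attach[OF grown.single]])
        (use fin sym y R_sym r0 in \<open>auto simp: part_def\<close>)
    show "grown B ({x} \<union> part Q 1 \<union> part b 1)"
      by (intro grown_attach[OF grown_attach[OF grown.single]])
        (use fin sym x B_sym b1 in \<open>auto simp: part_def\<close>)
    show "finite (U \<union> W)" using finite_sides by simp
    show "{y} \<union> part Q 0 \<union> part r 0 \<subseteq> U \<union> W" "{x} \<union> part Q 1 \<union> part b 1 \<subseteq> U \<union> W"
      using xy Q(1) rW by (auto simp: part_def)
    show "T \<subseteq> U \<union> W" using Tsub(1) rW by (auto simp: part_def bad_def)
    have WQ: "x \<notin> Q" "y \<notin> Q" "r \<inter> Q = {}" "b \<inter> Q = {}" "L \<inter> Q = {}"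
      using xy rW Q(1) disjoint_sides by blast+
    have bd: "x \<notin> bad" "y \<notin> bad" "r \<inter> bad = {}" "b \<inter> bad = {}" "Q \<inter> bad = {}"
      using xy rW disjoint_sides by (auto simp: bad_def)
    show "({y} \<union> part Q 0 \<union> part r 0) \<inter> ({x} \<union> part Q 1 \<union> part b 1) = {}"
      using xr xb yb yr WQ by (auto simp: part_def)
    show "({y} \<union> part Q 0 \<union> part r 0) \<inter> T = {}"
      using Tsub(1) bd WQ by (auto simp: part_def)
    show "({x} \<union> part Q 1 \<union> part b 1) \<inter> T = {}"
      using Tsub(1) bd WQ xb by (auto simp: part_def L_def)
    fix v assume v: "v \<in> U \<union> W" "v \<notin> T"
    then consider "v \<in> Q" | "v \<in> U" "v \<notin> Q" "v \<notin> bad" | "v \<in> r" | "v \<in> b"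
      using Tsub(2) rb by blast
    then show "(\<exists>u\<in>{y} \<union> part Q 0 \<union> part r 0. R v u) \<or> (\<exists>u\<in>{x} \<union> part Q 1 \<union> part b 1. B v u)"
    proof cases
      case 1
      then show ?thesis using y R_sym by blast
    next
      case 2
      then show ?thesis using good by blast
    next
      case 3
      then show ?thesis using r0 by blast
    next
      case 4
      then show ?thesis using b1 by blast
    qed
  qed
qed

text \<open>Exchanging the colours together with \<open>x\<close> and \<open>y\<close> exchanges
  \<open>r\<close> and \<open>b\<close>, so the comparison of their complements may be
  assumed.\<close>

lemma three_parts_common_side:
  assumes "x \<in> W" "y \<in> W" "Q \<subseteq> U" "10 * n \<le> 16 * card Q"
    and x: "\<And>q. q \<in> Q \<Longrightarrow> B x q" and y: "\<And>q. q \<in> Q \<Longrightarrow> R y q"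
  shows "three_parts (U \<union> W) R B"
proof -
  define r b where "r = {w\<in>W. m < card (nb R w Q)}" and "b = {w\<in>W. m < card (nb B w Q)}"
  interpret s: two_coloured_bipartite U W B R n m by (rule swap_colours)
  show ?thesis
  proof (cases "card (W - r) \<le> card (W - b)")
    case True
    then show ?thesis by (intro three_parts_common_side_aux[OF assms r_def b_def])
  next
    case False
    then have "three_parts (U \<union> W) B R"
      by (intro s.three_parts_common_side_aux[OF assms(2,1,3,4) y x b_def r_def]) auto
    then show ?thesis by (simp add: three_parts_commute)
  qed
qed


section \<open>Three trees when the centres lie on opposite sides and each has edges of one colour
  only\<close>

lemma nb_finite: "finite S \<Longrightarrow> finite (nb C v S)"
  by (simp add: nb_def)

lemma no_colour_nb_big:
  assumes "y \<in> U" "\<And>v. \<not> B y v"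
  shows "13 * n \<le> 16 * card (nb R y W)"
proof -
  have "nb B y W = {}" using assms(2) by auto
  then show ?thesis using card_le_neighbours[OF assms(1) order_refl] card_sides by simp
qed

text \<open>Of at least 13n/16 vertices in \<open>Q\<close>, \<open>u0\<close> misses at most 3n/16
  and sees at most \<open>m\<close> in red. The same loss at \<open>u\<close> leaves at least 7n/16
  - 2m common blue neighbours.\<close>

lemma bad_common_neighbours:
  assumes "Q \<subseteq> W" "13 * n \<le> 16 * card Q" "u \<in> U" "u0 \<in> U"
    "card (nb R u Q) \<le> m" "card (nb R u0 Q) \<le> m"
  shows "10 * n \<le> 16 * card (nb B u0 Q) + 16 * m"
    and "m < card (nb B u (nb B u0 Q))"
proof -
  show *: "10 * n \<le> 16 * card (nb B u0 Q) + 16 * m"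
    using card_le_neighbours[OF assms(4,1)] assms(2,6) by linarith
  have "card (nb R u (nb B u0 Q)) \<le> card (nb R u Q)"
    by (rule card_mono[OF nb_finite]) (use assms(1) finite_sides finite_subset in auto)
  moreover have "16 * card (nb B u0 Q) \<le>
      16 * card (nb R u (nb B u0 Q)) + 16 * card (nb B u (nb B u0 Q)) + 3 * n"
    by (rule card_le_neighbours) (use assms in auto)
  ultimately have "10 * n \<le> 32 * m + 16 * card (nb B u (nb B u0 Q)) + 3 * n"
    using * assms(5) by linarith
  then show "m < card (nb B u (nb B u0 Q))" using m_small by linarith
qed

text \<open>All of \<open>W\<close> finds a place: \<open>Q\<close> next to \<open>y\<close>, the
  rest by \<open>no_bad\<close> in the blue tree around \<open>x\<close>. Only vertices of
  \<open>U\<close> can be exceptional, and the reserved class of \<open>Q\<close> joins them in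
  blue.\<close>

lemma three_parts_no_bad_W:
  assumes x: "x \<in> W" "\<And>v. \<not> R x v" and y: "y \<in> U" "\<And>v. \<not> B y v"
    and no_bad: "\<And>w. w \<in> W - nb R y W \<Longrightarrow> m < card (nb B w (nb B x U))"
  shows "three_parts (U \<union> W) R B"
proof -
  define P Q where "P = nb B x U" and "Q = nb R y W"
  have PQ: "P \<subseteq> U" "Q \<subseteq> W" "finite P" "finite Q"
    using finite_sides by (auto simp: P_def Q_def intro: nb_finite)
  have Q_big: "13 * n \<le> 16 * card Q" unfolding Q_def by (rule no_colour_nb_big[OF y])
  define bad where "bad = {u\<in>U - P. card (nb R u Q) \<le> m}"
  have finbad: "finite bad" unfolding bad_def using finite_sides by auto
  \<comment> \<open>An arbitrary value if \<open>bad\<close> is empty; \<open>T\<close> is then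
    empty as well.\<close>
  define u0 where "u0 = (SOME u. u \<in> bad)"
  define F where "F = (\<lambda>u. nb R u Q) ` U \<union> (\<lambda>w. nb B w P) ` W \<union> (\<lambda>u. nb B u (nb B u0 Q)) ` U
    \<union> {} \<union> {}"
  have "card F \<le> 8 * n" unfolding F_def by (intro card_Un_five card_image_sides) auto
  moreover have "finite F" unfolding F_def using finite_sides by simp
  ultimately obtain f where f: "\<And>A i. A \<in> F \<Longrightarrow> A \<subseteq> U \<union> W \<Longrightarrow> m \<le> card A \<Longrightarrow> i < (3::nat) \<Longrightarrow> \<exists>a\<in>A. f a = i"
    using splitting by blast
  define part where "part S i = {v\<in>S. f v = i}" for S i
  have pfin: "finite (part P i)" "finite (part Q i)" for i using PQ by (auto simp: part_def)
  have yQ: "\<forall>v\<in>Q. R v y" and xP: "\<forall>v\<in>P. B v x" using R_sym B_sym by (auto simp: P_def Q_def)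
  have V: "P \<subseteq> U \<union> W" "Q \<subseteq> U \<union> W" using PQ by blast+
  have Q0: "\<exists>q\<in>part Q 0. R u q" if "u \<in> U" "u \<notin> P" "u \<notin> bad" for u
    using f[of "nb R u Q" 0] that V unfolding F_def part_def bad_def by force
  have P1: "\<exists>p\<in>part P 1. B w p" if "w \<in> W" "w \<notin> Q" for w
    using f[of "nb B w P" 1] that V no_bad[of w] unfolding F_def part_def P_def Q_def by force
  have T2: "\<exists>w\<in>nb B u0 (part Q 2). B u w" if "u \<in> bad" for u
  proof -
    have "u0 \<in> bad" unfolding u0_def using that by (rule someI)
    then have "m < card (nb B u (nb B u0 Q))"
      by (intro bad_common_neighbours[OF PQ(2) Q_big]) (use that in \<open>auto simp: bad_def\<close>)
    then show ?thesis
      using f[of "nb B u (nb B u0 Q)" 2] that V unfolding F_def part_def bad_def by force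
  qed
  define T where "T = (if bad = {} then {} else ({u0} \<union> nb B u0 (part Q 2)) \<union> bad)"
  have Tsub: "T \<subseteq> part Q 2 \<union> bad" "bad \<subseteq> T"
    unfolding T_def u0_def by (auto intro: someI)
  have T: "T = {} \<or> grown R T \<or> grown B T"
  proof -
    have "grown B (({u0} \<union> nb B u0 (part Q 2)) \<union> bad)"
    proof (intro grown_attach[OF grown_attach[OF grown.single]])
      show "finite (nb B u0 (part Q 2))" using PQ by (auto simp: nb_def part_def)
      show "v \<in> {u0} \<or> (\<exists>u\<in>{u0}. B v u)" if "v \<in> nb B u0 (part Q 2)" for v
        using that B_sym by auto
      show "v \<in> {u0} \<union> nb B u0 (part Q 2) \<or> (\<exists>u\<in>{u0} \<union> nb B u0 (part Q 2). B v u)"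
        if "v \<in> bad" for v
        using T2[OF that] by blast
    qed (use finbad sym in auto)
    then show ?thesis by (simp add: T_def)
  qed
  have xQ: "x \<notin> Q" using x R_sym by (auto simp: Q_def)
  have yP: "y \<notin> P" using y B_sym by (auto simp: P_def)
  \<comment> \<open>The centre \<open>y\<close> sees all of \<open>Q\<close> in red, so it is not
    itself exceptional.\<close>
  have "nb R y Q = Q" by (auto simp: Q_def)
  then have "y \<notin> bad" using Q_big m_small by (auto simp: bad_def)
  show ?thesis
  proof (rule three_parts_by_attaching[OF _ sym _ _ T])
    show "grown R ({y} \<union> part Q 0)"
      by (intro grown_attach[OF grown.single]) (use pfin sym yQ in \<open>auto simp: part_def\<close>)
    show "grown B ({x} \<union> part P 1)"
      by (intro grown_attach[OF grown.single]) (use pfin sym xP in \<open>auto simp: part_def\<close>)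
    show "finite (U \<union> W)" using finite_sides by simp
    show "{y} \<union> part Q 0 \<subseteq> U \<union> W" "{x} \<union> part P 1 \<subseteq> U \<union> W"
      using x y PQ by (auto simp: part_def)
    show "T \<subseteq> U \<union> W" using Tsub(1) PQ by (auto simp: part_def bad_def)
    have d: "x \<notin> bad" "y \<notin> Q" "x \<notin> P" "Q \<inter> bad = {}" "P \<inter> bad = {}" "P \<inter> Q = {}" "x \<noteq> y"
      using x y PQ disjoint_sides by (auto simp: bad_def)
    show "({y} \<union> part Q 0) \<inter> ({x} \<union> part P 1) = {}"
      using d xQ yP by (auto simp: part_def)
    show "({y} \<union> part Q 0) \<inter> T = {}" "({x} \<union> part P 1) \<inter> T = {}"
      using Tsub(1) d xQ yP \<open>y \<notin> bad\<close> by (auto simp: part_def)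
    fix v assume v: "v \<in> U \<union> W" "v \<notin> T"
    then consider "v \<in> P" | "v \<in> U" "v \<notin> P" "v \<notin> bad" | "v \<in> Q" | "v \<in> W" "v \<notin> Q"
      using Tsub(2) by blast
    then show "(\<exists>u\<in>{y} \<union> part Q 0. R v u) \<or> (\<exists>u\<in>{x} \<union> part P 1. B v u)"
    proof cases
      case 1
      then show ?thesis using xP by blast
    next
      case 2
      then show ?thesis using Q0 by blast
    next
      case 3
      then show ?thesis using yQ by blast
    next
      case 4
      then show ?thesis using P1 by blast
    qed
  qed
qed

text \<open>The blue edge \<open>ac\<close> joins the exceptional vertices of \<open>U\<close> to the blue tree around \<open>x\<close>,
  so that the third tree is free for the exceptional vertices of \<open>W\<close>.\<close>

lemma three_parts_linked_bad:
  assumes x: "x \<in> W" "\<And>v. \<not> R x v" and y: "y \<in> U" "\<And>v. \<not> B y v"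
    and u0: "u0 \<in> U - nb B x U" "card (nb R u0 (nb R y W)) \<le> m"
    and w0: "w0 \<in> W - nb R y W" "card (nb B w0 (nb B x U)) \<le> m"
    and a: "a \<in> nb R y W" "B u0 a" and c: "c \<in> nb B x U" "R w0 c" and ac: "B a c"
  shows "three_parts (U \<union> W) R B"
proof -
  interpret s: two_coloured_bipartite W U B R n m
    using two_coloured_bipartite.swap_colours[OF swap_sides] .
  define P Q where "P = nb B x U" and "Q = nb R y W"
  have PQ: "P \<subseteq> U" "Q \<subseteq> W" "finite P" "finite Q"
    using finite_sides by (auto simp: P_def Q_def intro: nb_finite)
  have Q_big: "13 * n \<le> 16 * card Q" unfolding Q_def by (rule no_colour_nb_big[OF y])
  have P_big: "13 * n \<le> 16 * card P" unfolding P_def by (rule s.no_colour_nb_big[OF x])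
  define badU where "badU = {u\<in>U - P. card (nb R u Q) \<le> m}"
  define badW where "badW = {w\<in>W - Q. card (nb B w P) \<le> m}"
  have fin: "finite badU" "finite badW" unfolding badU_def badW_def using finite_sides by auto
  have u0b: "u0 \<in> badU" and w0b: "w0 \<in> badW" using u0 w0 by (auto simp: badU_def badW_def P_def Q_def)
  have aQ: "a \<in> Q" and cP: "c \<in> P" using a c by (auto simp: P_def Q_def)
  \<comment> \<open>The vertices \<open>a\<close> and \<open>c\<close> belong to the blue tree
    whatever their classes. They are therefore deleted from the sets through which vertices attach
    to the two red trees; the thresholds above \<open>m\<close> pay for this.\<close>
  define F where "F = (\<lambda>u. nb R u Q - {a}) ` U \<union> (\<lambda>w. nb B w P) ` W
    \<union> (\<lambda>u. nb B u (nb B u0 Q)) ` U \<union> (\<lambda>w. nb R w (nb R w0 P) - {c}) ` W \<union> {}"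
  have "card F \<le> 8 * n" unfolding F_def by (intro card_Un_five card_image_sides) auto
  moreover have "finite F" unfolding F_def using finite_sides by simp
  ultimately obtain f where f: "\<And>A i. A \<in> F \<Longrightarrow> A \<subseteq> U \<union> W \<Longrightarrow> m \<le> card A \<Longrightarrow> i < (3::nat) \<Longrightarrow> \<exists>a\<in>A. f a = i"
    using splitting by blast
  define part where "part S i = {v\<in>S. f v = i}" for S i
  have pfin: "finite (part P i)" "finite (part Q i)" for i using PQ by (auto simp: part_def)
  have yQ: "\<forall>v\<in>Q. R v y" and xP: "\<forall>v\<in>P. B v x" using R_sym B_sym by (auto simp: P_def Q_def)
  have V: "P \<subseteq> U \<union> W" "Q \<subseteq> U \<union> W" using PQ by blast+
  have minus: "m \<le> card (A - {v})" "A - {v} \<subseteq> U \<union> W" if "m < card A" "A \<subseteq> U \<union> W" for A v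
    using that card_Diff_singleton_if[of A v] by auto
  have Q0: "\<exists>q\<in>part Q 0 - {a}. R u q" if "u \<in> U" "u \<notin> P" "u \<notin> badU" for u
  proof -
    have "m < card (nb R u Q)" using that by (auto simp: badU_def)
    then have "\<exists>q\<in>nb R u Q - {a}. f q = 0"
      by (intro f minus) (use that V in \<open>auto simp: F_def simp del: nb_iff\<close>)
    then show ?thesis by (auto simp: part_def)
  qed
  have P1: "\<exists>p\<in>part P 1. B w p" if "w \<in> W" "w \<notin> Q" "w \<notin> badW" for w
    using f[of "nb B w P" 1] that V unfolding F_def part_def badW_def by force
  have U2: "\<exists>w\<in>nb B u0 (part Q 2). B u w" if "u \<in> badU" for u
  proof -
    have "m < card (nb B u (nb B u0 Q))"
      by (intro bad_common_neighbours[OF PQ(2) Q_big]) (use that u0b in \<open>auto simp: badU_def\<close>)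
    then show ?thesis
      using f[of "nb B u (nb B u0 Q)" 2] that V unfolding F_def part_def badU_def by force
  qed
  have W2: "\<exists>u\<in>nb R w0 (part P 2) - {c}. R w u" if "w \<in> badW" for w
  proof -
    have "m < card (nb R w (nb R w0 P))"
      by (intro s.bad_common_neighbours[OF PQ(1) P_big]) (use that w0b in \<open>auto simp: badW_def\<close>)
    then have "\<exists>q\<in>nb R w (nb R w0 P) - {c}. f q = 2"
      by (intro f minus) (use that V in \<open>auto simp: F_def badW_def simp del: nb_iff\<close>)
    then show ?thesis by (auto simp: part_def)
  qed
  define C where "C = {y} \<union> (part Q 0 - {a})"
  \<comment> \<open>The blue chain \<open>x\<close>, \<open>c\<close>, \<open>a\<close>,
    \<open>u0\<close> leads from the star around \<open>x\<close> to the exceptional vertices of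
    \<open>U\<close>, which hang from \<open>nb B u0 (part Q 2)\<close>.\<close>
  define D where "D = {x} \<union> (part P 1 \<union> {c}) \<union> {a} \<union> {u0} \<union> nb B u0 (part Q 2) \<union> badU"
  define T where "T = {w0} \<union> (nb R w0 (part P 2) - {c}) \<union> badW"
  have gC: "grown R C" unfolding C_def
    by (intro grown_attach[OF grown.single])
      (use pfin sym yQ in \<open>auto simp: part_def\<close>)
  have "grown B ({x} \<union> (part P 1 \<union> {c}))"
    by (intro grown_attach[OF grown.single])
      (use pfin sym xP cP in \<open>auto simp: part_def\<close>)
  then have "grown B ({x} \<union> (part P 1 \<union> {c}) \<union> {a})"
    by (rule grown_attach) (use sym ac in auto)
  then have "grown B ({x} \<union> (part P 1 \<union> {c}) \<union> {a} \<union> {u0})"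
    by (rule grown_attach) (use sym a in auto)
  then have "grown B ({x} \<union> (part P 1 \<union> {c}) \<union> {a} \<union> {u0} \<union> nb B u0 (part Q 2))"
    by (rule grown_attach) (use sym pfin B_sym in \<open>auto intro: nb_finite\<close>)
  then have gD: "grown B D" unfolding D_def
    by (rule grown_attach) (use sym fin U2 in blast)+
  have "grown R ({w0} \<union> (nb R w0 (part P 2) - {c}))"
    by (intro grown_attach[OF grown.single])
      (use pfin sym R_sym in \<open>auto intro: nb_finite\<close>)
  then have gT: "grown R T" unfolding T_def
    by (rule grown_attach) (use sym fin W2 in blast)+
  have xQ: "x \<notin> Q" using x R_sym by (auto simp: Q_def)
  have yP: "y \<notin> P" using y B_sym by (auto simp: P_def)
  have "nb R y Q = Q" "nb B x P = P" by (auto simp: Q_def P_def)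
  then have bad: "y \<notin> badU" "x \<notin> badW" using Q_big P_big m_small by (auto simp: badU_def badW_def)
  have Csub: "C \<subseteq> {y} \<union> (part Q 0 - {a})" by (simp add: C_def)
  have Dsub: "D \<subseteq> {x} \<union> part P 1 \<union> {c} \<union> {a} \<union> part Q 2 \<union> badU"
    using u0b by (auto simp: D_def)
  have Tsub: "T \<subseteq> badW \<union> (part P 2 - {c})" using w0b by (auto simp: T_def)
  have d: "x \<notin> badU" "y \<notin> badW" "y \<notin> Q" "x \<notin> P" "Q \<inter> badU = {}" "P \<inter> badU = {}"
      "P \<inter> badW = {}" "Q \<inter> badW = {}" "P \<inter> Q = {}" "x \<noteq> y" "badU \<inter> badW = {}"
    using x y PQ disjoint_sides by (auto simp: badU_def badW_def)
  have sub: "C \<subseteq> U \<union> W" "D \<subseteq> U \<union> W" "T \<subseteq> U \<union> W"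
  proof -
    show "C \<subseteq> U \<union> W" using Csub y PQ by (auto simp: part_def)
    show "D \<subseteq> U \<union> W" using Dsub x PQ aQ cP by (auto simp: part_def badU_def)
    show "T \<subseteq> U \<union> W" using Tsub PQ by (auto simp: part_def badW_def)
  qed
  have disj: "C \<inter> D = {}" "C \<inter> T = {}" "D \<inter> T = {}"
  proof -
    have pt: "part P i \<subseteq> P" "part Q i \<subseteq> Q" "part P 1 \<inter> part P 2 = {}" "part Q 0 \<inter> part Q 2 = {}" for i
      by (auto simp: part_def)
    let ?D = "{x} \<union> part P 1 \<union> {c} \<union> {a} \<union> part Q 2 \<union> badU"
      and ?T = "badW \<union> (part P 2 - {c})"
    have y_notin: "y \<notin> ?D" "y \<notin> ?T"
      using d(2,3,10) yP aQ cP bad(1) pt(1)[of 1] pt(1)[of 2] pt(2)[of 2] by blast+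
    have x_notin: "x \<notin> ?T" "x \<notin> part Q 0"
      using d(4) xQ bad(2) pt(1)[of 2] pt(2)[of 0] by blast+
    have "(part Q 0 - {a}) \<inter> (part P 1 \<union> {c} \<union> {a} \<union> part Q 2 \<union> badU) = {}"
      using pt(2)[of 0] pt(1)[of 1] pt(4) d(5,9) cP by blast
    then have "({y} \<union> (part Q 0 - {a})) \<inter> ?D = {}" using y_notin(1) x_notin(2) by blast
    then show "C \<inter> D = {}" using Csub Dsub by blast
    have "(part Q 0 - {a}) \<inter> ?T = {}"
      using pt(2)[of 0] pt(1)[of 2] d(8,9) by blast
    then have "({y} \<union> (part Q 0 - {a})) \<inter> ?T = {}" using y_notin(2) by blast
    then show "C \<inter> T = {}" using Csub Tsub by blast
    have "(part P 1 \<union> {c} \<union> {a} \<union> part Q 2 \<union> badU) \<inter> ?T = {}"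
      using pt(1)[of 1] pt(1)[of 2] pt(2)[of 2] pt(3) d(6-9,11) aQ cP by blast
    then have "?D \<inter> ?T = {}" using x_notin(1) by blast
    then show "D \<inter> T = {}" using Dsub Tsub by blast
  qed
  show ?thesis
  proof (rule three_parts_by_attaching[OF _ sym gC gD _ sub disj])
    show "finite (U \<union> W)" using finite_sides by simp
    show "T = {} \<or> grown R T \<or> grown B T" using gT by simp
    fix v assume v: "v \<in> U \<union> W" "v \<notin> D" "v \<notin> T"
    have sub: "badU \<subseteq> D" "badW \<subseteq> T" "x \<in> D" "y \<in> C" "part Q 0 - {a} \<subseteq> C" "part P 1 \<subseteq> D"
      by (auto simp: D_def T_def C_def)
    consider "v \<in> P" | "v \<in> U" "v \<notin> P" "v \<notin> badU" | "v \<in> Q" | "v \<in> W" "v \<notin> Q" "v \<notin> badW"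
      using v sub(1,2) by blast
    then show "(\<exists>u\<in>C. R v u) \<or> (\<exists>u\<in>D. B v u)"
    proof cases
      case 1
      then show ?thesis using xP sub(3) by blast
    next
      case 2
      then show ?thesis using Q0 sub(5) by blast
    next
      case 3
      then show ?thesis using yQ sub(4) by blast
    next
      case 4
      then show ?thesis using P1 sub(6) by blast
    qed
  qed
qed

text \<open>The neighbourhoods of exceptional \<open>u0\<close> and \<open>w0\<close> are so large that some edge \<open>ac\<close> joins them;
  exchanging sides and colours, it may be taken to be blue.\<close>

lemma three_parts_opposite_sides:
  assumes x: "x \<in> W" "\<And>v. \<not> R x v" and y: "y \<in> U" "\<And>v. \<not> B y v"
  shows "three_parts (U \<union> W) R B"
proof -
  interpret s: two_coloured_bipartite W U B R n m
    using two_coloured_bipartite.swap_colours[OF swap_sides] .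
  have swap: "three_parts (W \<union> U) B R = three_parts (U \<union> W) R B"
    by (simp add: three_parts_commute Un_commute)
  show ?thesis
  \<comment> \<open>If one side has no exceptional vertex, the third tree is free for the other
    side.\<close>
  proof (cases "(\<forall>w\<in>W - nb R y W. m < card (nb B w (nb B x U)))
      \<or> (\<forall>u\<in>U - nb B x U. m < card (nb R u (nb R y W)))")
    case True
    then show ?thesis
      using three_parts_no_bad_W[OF x y] s.three_parts_no_bad_W[OF y x] swap by blast
  next
    case False
    then obtain u0 w0 where u0: "u0 \<in> U - nb B x U" "card (nb R u0 (nb R y W)) \<le> m"
      and w0: "w0 \<in> W - nb R y W" "card (nb B w0 (nb B x U)) \<le> m"
      by (meson not_less)
    have Q: "10 * n \<le> 16 * card (nb B u0 (nb R y W)) + 16 * m"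
      by (rule bad_common_neighbours(1)[OF _ no_colour_nb_big[OF y], of u0 u0]) (use u0 in auto)
    have P: "10 * n \<le> 16 * card (nb R w0 (nb B x U)) + 16 * m"
      by (rule s.bad_common_neighbours(1)[OF _ s.no_colour_nb_big[OF x], of w0 w0]) (use w0 in auto)
    have "nb B u0 (nb R y W) \<noteq> {}" using Q m_small by auto
    then obtain a where "a \<in> nb B u0 (nb R y W)" by blast
    then have a: "a \<in> nb R y W" "B u0 a" by simp_all
    have aW: "a \<in> W" using a by simp
    \<comment> \<open>The vertex \<open>a\<close> misses at most 3n/16 of \<open>U\<close>, while
      \<open>w0\<close> has at least 10n/16 - m red neighbours in \<open>nb B x U\<close>, so
      \<open>a\<close> is adjacent to one of them.\<close>
    have "16 * card (nb R w0 (nb B x U)) \<le> 16 * card (nb R a (nb R w0 (nb B x U)))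
        + 16 * card (nb B a (nb R w0 (nb B x U))) + 3 * n"
      by (rule card_le_neighbours'[OF aW]) auto
    then have "nb R a (nb R w0 (nb B x U)) \<noteq> {} \<or> nb B a (nb R w0 (nb B x U)) \<noteq> {}"
      using P m_small by auto
    then obtain c where "c \<in> nb R a (nb R w0 (nb B x U)) \<or> c \<in> nb B a (nb R w0 (nb B x U))"
      by blast
    then have c: "c \<in> nb B x U" "R w0 c" and ac: "B a c \<or> R c a"
      using R_sym[of a c] by auto
    then show ?thesis
      using three_parts_linked_bad[OF x y u0 w0 a c]
        s.three_parts_linked_bad[OF y x w0 u0 c a] swap by blast
  qed
qed


section \<open>Monochromatic components and vertices separated in both colours\<close>

lemma reach_sym: "R\<^sup>*\<^sup>* u v \<Longrightarrow> R\<^sup>*\<^sup>* v u" "B\<^sup>*\<^sup>* u v \<Longrightarrow> B\<^sup>*\<^sup>* v u"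
  using sym by (metis sympD symp_rtranclp)+

lemma reach_closed: "R\<^sup>*\<^sup>* u v \<Longrightarrow> u \<in> U \<union> W \<Longrightarrow> v \<in> U \<union> W"
  by (induction rule: rtranclp_induct) (use bipartite in auto)

lemma reach_class_eq: "R\<^sup>*\<^sup>* u v \<Longrightarrow> {w. R\<^sup>*\<^sup>* u w} = {w. R\<^sup>*\<^sup>* v w}"
  using reach_sym(1) by (auto intro: rtranclp_trans)

text \<open>Nothing has to be attached here: the red components, isolated vertices included, are the
  parts.\<close>

lemma three_parts_few_classes:
  assumes "card ((\<lambda>v. {w. R\<^sup>*\<^sup>* v w}) ` (U \<union> W)) \<le> 3"
  shows "three_parts (U \<union> W) R B"
proof -
  let ?P = "(\<lambda>v. {w. R\<^sup>*\<^sup>* v w}) ` (U \<union> W)"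
  have sub: "{w. R\<^sup>*\<^sup>* v w} \<subseteq> U \<union> W" if "v \<in> U \<union> W" for v
    using reach_closed that by blast
  have "partition_on (U \<union> W) ?P"
  proof (rule partition_onI)
    show "\<Union>?P = U \<union> W" using sub by blast
    show "disjnt p q" if pq: "p \<in> ?P" "q \<in> ?P" "p \<noteq> q" for p q
    proof -
      obtain u v where uv: "p = {w. R\<^sup>*\<^sup>* u w}" "q = {w. R\<^sup>*\<^sup>* v w}" using pq by blast
      have False if "R\<^sup>*\<^sup>* u w" "R\<^sup>*\<^sup>* v w" for w
        using reach_class_eq[OF that(1)] reach_class_eq[OF that(2)] pq(3) uv by simp
      then show ?thesis unfolding disjnt_def uv by blast
    qed
  qed auto
  moreover have "finite ?P" using finite_sides by simp
  moreover have "grown R X" if X: "X \<in> ?P" for X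
  proof -
    obtain v where v: "v \<in> U \<union> W" "X = {w. R\<^sup>*\<^sup>* v w}" using X by blast
    then have "finite X" using sub[OF v(1)] finite_sides finite_subset by blast
    then show ?thesis using grown_reachable[of R v] v(2) by simp
  qed
  ultimately show ?thesis unfolding three_parts_def using assms by blast
qed

definition apart :: "'v \<Rightarrow> 'v \<Rightarrow> bool" where
  "apart a b \<longleftrightarrow> \<not> R\<^sup>*\<^sup>* a b \<and> \<not> B\<^sup>*\<^sup>* a b"

lemma common_neighbour_apart:
  assumes "apart a b"
  shows "\<not> (R a w \<and> R b w)" "\<not> (B a w \<and> B b w)"
proof -
  have "R\<^sup>*\<^sup>* a b" if "R a w" "R b w"
    using that R_sym by (meson converse_rtranclp_into_rtranclp r_into_rtranclp)
  moreover have "B\<^sup>*\<^sup>* a b" if "B a w" "B b w"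
    using that B_sym by (meson converse_rtranclp_into_rtranclp r_into_rtranclp)
  ultimately show "\<not> (R a w \<and> R b w)" "\<not> (B a w \<and> B b w)"
    using assms by (auto simp: apart_def)
qed

text \<open>Three vertices together miss at most 9n/16 of \<open>W\<close>, so they have a common
  neighbour. Two of its edges to them share a colour and put two of the vertices into one
  component.\<close>

lemma no_three_apart:
  assumes "a \<in> U" "b \<in> U" "c \<in> U" "apart a b" "apart a c" "apart b c"
  shows False
proof -
  let ?M = "\<lambda>u. {w\<in>W. \<not> R u w \<and> \<not> B u w}"
  have "card (?M a \<union> ?M b \<union> ?M c) \<le> card (?M a) + card (?M b) + card (?M c)"
    by (meson card_Un_le add_mono order_refl order_trans)
  then have "card (?M a \<union> ?M b \<union> ?M c) < card W"
    using missing_U[OF assms(1)] missing_U[OF assms(2)] missing_U[OF assms(3)] card_sides m_small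
    by linarith
  then have "\<not> W \<subseteq> ?M a \<union> ?M b \<union> ?M c"
    using card_mono[of "?M a \<union> ?M b \<union> ?M c" W] finite_sides by auto
  then obtain w where "(R a w \<or> B a w) \<and> (R b w \<or> B b w) \<and> (R c w \<or> B c w)" by blast
  then show False using common_neighbour_apart assms(4-6) by blast
qed

lemma many_common_neighbours:
  assumes "a \<in> U" "b \<in> U"
  shows "10 * n \<le> 16 * card {w\<in>W. (R a w \<or> B a w) \<and> (R b w \<or> B b w)}"
proof -
  let ?M = "\<lambda>u. {w\<in>W. \<not> R u w \<and> \<not> B u w}"
  let ?S = "{w\<in>W. (R a w \<or> B a w) \<and> (R b w \<or> B b w)}"
  have "card W \<le> card (?S \<union> ?M a \<union> ?M b)"
    by (rule card_mono) (use finite_sides in auto)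
  also have "\<dots> \<le> card ?S + card (?M a) + card (?M b)"
    by (meson card_Un_le add_mono order_refl order_trans)
  finally show ?thesis
    using missing_U[OF assms(1)] missing_U[OF assms(2)] card_sides by linarith
qed

text \<open>A common neighbour \<open>w\<close> of \<open>a\<close> and \<open>b\<close> has one
  edge of each colour to them, and so has a common neighbour \<open>u\<close> of \<open>c\<close>
  and \<open>d\<close> to these. If \<open>u\<close> and \<open>w\<close> are adjacent, their edge,
  whatever its colour, completes a monochromatic path between the two pairs.\<close>

lemma no_two_two_apart:
  assumes "a \<in> U" "b \<in> U" "c \<in> W" "d \<in> W" "apart a b" "apart c d"
    "apart a c" "apart a d" "apart b c" "apart b d"
  shows False
proof -
  interpret s: two_coloured_bipartite W U R B n m by (rule swap_sides)
  let ?S = "{w\<in>W. (R a w \<or> B a w) \<and> (R b w \<or> B b w)}"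
  let ?S' = "{u\<in>U. (R c u \<or> B c u) \<and> (R d u \<or> B d u)}"
  have S: "10 * n \<le> 16 * card ?S" by (rule many_common_neighbours[OF assms(1,2)])
  have S': "10 * n \<le> 16 * card ?S'" by (rule s.many_common_neighbours[OF assms(3,4)])
  have "?S \<noteq> {}" using S m_small by (metis card.empty mult_is_0 le_zero_eq add_is_0 zero_neq_numeral)
  then obtain w where w: "w \<in> W" "R a w \<or> B a w" "R b w \<or> B b w" by blast
  \<comment> \<open>An adjacent \<open>u\<close> exists because \<open>w\<close> misses at most
    3n/16 of \<open>U\<close>, while there are at least 10n/16 candidates.\<close>
  have "16 * card ?S' \<le> 16 * card (nb R w ?S') + 16 * card (nb B w ?S') + 3 * n"
    by (rule card_le_neighbours'[OF w(1)]) auto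
  then have "card (nb R w ?S') \<noteq> 0 \<or> card (nb B w ?S') \<noteq> 0"
    using S' m_small by linarith
  then have "nb R w ?S' \<noteq> {} \<or> nb B w ?S' \<noteq> {}" by auto
  then obtain u where "u \<in> nb R w ?S' \<or> u \<in> nb B w ?S'" by blast
  then have u: "R c u \<or> B c u" "R d u \<or> B d u" "R w u \<or> B w u" by auto
  have red: "R\<^sup>*\<^sup>* p q" if "R p w" "R w u" "R q u" for p q
    using that R_sym by (meson converse_rtranclp_into_rtranclp r_into_rtranclp)
  have blue: "B\<^sup>*\<^sup>* p q" if "B p w" "B w u" "B q u" for p q
    using that B_sym by (meson converse_rtranclp_into_rtranclp r_into_rtranclp)
  have "\<not> (R a w \<and> R b w)" "\<not> (B a w \<and> B b w)" "\<not> (R c u \<and> R d u)" "\<not> (B c u \<and> B d u)"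
    using common_neighbour_apart assms(5,6) by blast+
  then show False
    using u w red blue assms(7-10) unfolding apart_def by blast
qed

lemma no_four_apart:
  assumes "S \<subseteq> U \<union> W" "card S = 4" "\<And>a b. a \<in> S \<Longrightarrow> b \<in> S \<Longrightarrow> a \<noteq> b \<Longrightarrow> apart a b"
  shows False
proof -
  interpret s: two_coloured_bipartite W U R B n m by (rule swap_sides)
  have fin: "finite S" using assms(2) card.infinite by fastforce
  have "S = (S \<inter> U) \<union> (S \<inter> W)" using assms(1) by blast
  then have sum: "card (S \<inter> U) + card (S \<inter> W) = 4"
    using card_Un_disjoint[of "S \<inter> U" "S \<inter> W"] fin disjoint_sides assms(2) by auto
  have three: "\<exists>a b c. a \<in> A \<and> b \<in> A \<and> c \<in> A \<and> a \<noteq> b \<and> a \<noteq> c \<and> b \<noteq> c" if A: "3 \<le> card A" for A :: "'v set"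
  proof -
    obtain T where "T \<subseteq> A" "card T = 3" using obtain_subset_with_card_n[OF A] by metis
    then show ?thesis unfolding card_3_iff by blast
  qed
  have two: "\<exists>a b. a \<in> A \<and> b \<in> A \<and> a \<noteq> b" if "card A = 2" for A :: "'v set"
    using that unfolding card_2_iff by blast
  consider "3 \<le> card (S \<inter> U)" | "3 \<le> card (S \<inter> W)" | "card (S \<inter> U) = 2" "card (S \<inter> W) = 2"
    using sum by linarith
  then show False
  proof cases
    case 1
    obtain a b c where "a \<in> S \<inter> U" "b \<in> S \<inter> U" "c \<in> S \<inter> U" "a \<noteq> b" "a \<noteq> c" "b \<noteq> c"
      using three[OF 1] by blast
    then show ?thesis using assms(3) by - (rule no_three_apart[of a b c]; blast)
  next
    case 2
    obtain a b c where "a \<in> S \<inter> W" "b \<in> S \<inter> W" "c \<in> S \<inter> W" "a \<noteq> b" "a \<noteq> c" "b \<noteq> c"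
      using three[OF 2] by blast
    then show ?thesis
      using assms(3) by - (rule s.no_three_apart[of a b c]; blast)
  next
    case 3
    obtain a b where ab: "a \<in> S \<inter> U" "b \<in> S \<inter> U" "a \<noteq> b" using two[OF 3(1)] by blast
    obtain c d where cd: "c \<in> S \<inter> W" "d \<in> S \<inter> W" "c \<noteq> d" using two[OF 3(2)] by blast
    have "a \<noteq> c" "a \<noteq> d" "b \<noteq> c" "b \<noteq> d" using ab cd disjoint_sides by auto
    then show ?thesis using ab cd assms(3) by - (rule no_two_two_apart[of a b c d]; blast)
  qed
qed

text \<open>If \<open>x\<close> had a red edge to a common neighbour \<open>q\<close>, then
  \<open>q\<close> would lie in the red component of \<open>x\<close>. So the edge from
  \<open>y\<close> to \<open>q\<close> could not be blue, and if red it would put \<open>y\<close>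
  into both components. Hence \<open>x\<close> sends only blue edges to \<open>Q\<close>, and a blue
  edge from \<open>y\<close> would put \<open>x\<close> into both components.\<close>

lemma three_parts_disjoint_same_side:
  assumes "x \<in> W" "y \<in> W" and disj: "\<And>v. \<not> (R\<^sup>*\<^sup>* x v \<and> B\<^sup>*\<^sup>* y v)"
  shows "three_parts (U \<union> W) R B"
proof -
  interpret s: two_coloured_bipartite W U R B n m by (rule swap_sides)
  define Q where "Q = {q\<in>U. (R x q \<or> B x q) \<and> (R y q \<or> B y q)}"
  have x_blue: "B x q" if "q \<in> Q" for q
  proof (rule ccontr)
    assume "\<not> B x q"
    then have R: "R x q" using that by (simp add: Q_def)
    have "\<not> B y q" using disj[of q] R by blast
    then have "R y q" using that by (simp add: Q_def)
    then have "R\<^sup>*\<^sup>* x y" using R R_sym by (meson converse_rtranclp_into_rtranclp r_into_rtranclp)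
    then show False using disj[of y] by blast
  qed
  have y_red: "R y q" if "q \<in> Q" for q
  proof (rule ccontr)
    assume "\<not> R y q"
    then have "B y q" using that by (simp add: Q_def)
    then have "B\<^sup>*\<^sup>* y x" using x_blue[OF that] B_sym
      by (meson converse_rtranclp_into_rtranclp r_into_rtranclp)
    then show False using disj[of x] by blast
  qed
  show ?thesis
    by (rule three_parts_common_side[OF assms(1,2) _ _ x_blue y_red])
      (use s.many_common_neighbours[OF assms(1,2)] in \<open>auto simp: Q_def\<close>)
qed

lemma three_parts_exist: "three_parts (U \<union> W) R B"
proof -
  interpret s: two_coloured_bipartite W U R B n m by (rule swap_sides)
  interpret c: two_coloured_bipartite U W B R n m by (rule swap_colours)
  let ?r = "\<lambda>v. {w. R\<^sup>*\<^sup>* v w}" and ?b = "\<lambda>v. {w. B\<^sup>*\<^sup>* v w}"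
  let ?V = "U \<union> W"
  consider "card (?r ` ?V) \<le> 3" | "card (?b ` ?V) \<le> 3"
    | x y where "x \<in> ?V" "y \<in> ?V" "?r x \<inter> ?b y = {}"
    | "4 \<le> card (?r ` ?V)" "4 \<le> card (?b ` ?V)"
      "\<And>x y. x \<in> ?V \<Longrightarrow> y \<in> ?V \<Longrightarrow> ?r x \<inter> ?b y \<noteq> {}"
    by fastforce
  then show ?thesis
  proof cases
    case 1
    then show ?thesis by (rule three_parts_few_classes)
  next
    case 2
    then show ?thesis using c.three_parts_few_classes by (simp add: three_parts_commute)
  next
    case (3 x y)
    then have disj: "\<not> (R\<^sup>*\<^sup>* x v \<and> B\<^sup>*\<^sup>* y v)" for v by blast
    \<comment> \<open>Disjointness passes to all representatives of the two components, so any two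
      on a common side will do.\<close>
    have same: ?thesis if "R\<^sup>*\<^sup>* x x'" "B\<^sup>*\<^sup>* y y'" "x' \<in> W \<and> y' \<in> W \<or> x' \<in> U \<and> y' \<in> U" for x' y'
    proof -
      have "\<not> (R\<^sup>*\<^sup>* x' v \<and> B\<^sup>*\<^sup>* y' v)" for v
        using disj that by (meson rtranclp_trans)
      then show ?thesis
        using that(3) three_parts_disjoint_same_side[of x' y'] s.three_parts_disjoint_same_side[of x' y']
        by (auto simp: Un_commute)
    qed
    show ?thesis
    proof (cases "\<exists>x' y'. R\<^sup>*\<^sup>* x x' \<and> B\<^sup>*\<^sup>* y y' \<and> (x' \<in> W \<and> y' \<in> W \<or> x' \<in> U \<and> y' \<in> U)")
      case True
      then show ?thesis using same by blast
    next
      case False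
      \<comment> \<open>Now no vertex in the red component of \<open>x\<close> shares a side with
        one in the blue component of \<open>y\<close>. So \<open>x\<close> and \<open>y\<close> are
        on opposite sides. A red neighbour of \<open>x\<close> would be on the side of
        \<open>y\<close>, and a blue neighbour of \<open>y\<close> on the side of
        \<open>x\<close>.\<close>
      then have opp: "\<not> (x \<in> W \<and> y \<in> W)" "\<not> (x \<in> U \<and> y \<in> U)" by blast+
      have xv: "\<not> R x v" for v
        using False opp 3(1,2) bipartite[of x v] by (metis UnE r_into_rtranclp rtranclp.rtrancl_refl)
      have yv: "\<not> B y v" for v
        using False opp 3(1,2) bipartite[of y v] by (metis UnE r_into_rtranclp rtranclp.rtrancl_refl)
      show ?thesis
        using opp 3(1,2) three_parts_opposite_sides[of x y] s.three_parts_opposite_sides[of x y] xv yv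
        by (auto simp: Un_commute)
    qed
  next
    case 4
    obtain Kr where Kr: "Kr \<subseteq> ?r ` ?V" "card Kr = 4" using obtain_subset_with_card_n[OF 4(1)] by metis
    obtain Kb where Kb: "Kb \<subseteq> ?b ` ?V" "card Kb = 4" using obtain_subset_with_card_n[OF 4(2)] by metis
    \<comment> \<open>Four red and four blue components are matched arbitrarily. A vertex from each
      of the four intersections gives four pairwise \<open>apart\<close> vertices.\<close>
    obtain h where h: "bij_betw h {0..<4::nat} Kr"
      using ex_bij_betw_nat_finite[of Kr] Kr(2) card.infinite[of Kr] by fastforce
    obtain k where k: "bij_betw k {0..<4::nat} Kb"
      using ex_bij_betw_nat_finite[of Kb] Kb(2) card.infinite[of Kb] by fastforce
    have hk: "h i \<in> ?r ` ?V \<and> k i \<in> ?b ` ?V" if "i \<in> {0..<4}" for i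
      using bij_betwE[OF h] bij_betwE[OF k] Kr(1) Kb(1) that by blast
    have "\<exists>v. v \<in> h i \<inter> k i \<and> v \<in> ?V" if i: "i \<in> {0..<4}" for i
    proof -
      obtain x y where xy: "x \<in> ?V" "y \<in> ?V" "h i = ?r x" "k i = ?b y"
        using hk[OF i] by (elim conjE imageE)
      then obtain v where "v \<in> ?r x \<inter> ?b y" using 4(3) by blast
      then show ?thesis using xy reach_closed[of x v] by auto
    qed
    then obtain v where v: "\<And>i. i \<in> {0..<4} \<Longrightarrow> v i \<in> h i \<inter> k i \<and> v i \<in> ?V" by metis
    have hr: "h i = ?r (v i)" and kb: "k i = ?b (v i)" if i: "i \<in> {0..<4}" for i
    proof -
      obtain x y where x: "h i = ?r x" and y: "k i = ?b y" using hk[OF i] by (elim conjE imageE)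
      have "R\<^sup>*\<^sup>* x (v i)" "B\<^sup>*\<^sup>* y (v i)" using v[OF i] x y by simp_all
      then show "h i = ?r (v i)" "k i = ?b (v i)"
        unfolding x y by (simp_all add: reach_class_eq c.reach_class_eq)
    qed
    have ap: "apart (v i) (v j)" if "i \<in> {0..<4}" "j \<in> {0..<4}" "i \<noteq> j" for i j
    proof -
      have "h i \<noteq> h j" "k i \<noteq> k j"
        using inj_onD[OF bij_betw_imp_inj_on[OF h]] inj_onD[OF bij_betw_imp_inj_on[OF k]] that by blast+
      then show ?thesis
        unfolding apart_def hr[OF that(1)] hr[OF that(2)] kb[OF that(1)] kb[OF that(2)]
        using reach_class_eq[of "v i" "v j"] c.reach_class_eq[of "v i" "v j"] by blast
    qed
    have "inj_on v {0..<4}"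
      using ap by (metis apart_def inj_onI rtranclp.rtrancl_refl)
    then have "card (v ` {0..<4}) = 4" by (simp add: card_image)
    moreover have "v ` {0..<4} \<subseteq> ?V" using v by blast
    ultimately have False using no_four_apart[of "v ` {0..<4}"] ap by blast
    then show ?thesis ..
  qed
qed

end

section \<open>From grown sets to trees\<close>

lemma cas_nth_Suc:
  assumes "pre_digraph.cas G u p v" "Suc i < length p"
  shows "head G (p ! i) = tail G (p ! Suc i)"
  using assms
proof (induction p arbitrary: u i)
  case Nil
  then show ?case by simp
next
  case (Cons a p)
  interpret pre_digraph G .
  show ?case
  proof (cases i)
    case 0
    then show ?thesis using Cons.prems by (cases p) auto
  next
    case (Suc j)
    then show ?thesis using Cons.prems Cons.IH[of "head G a" j] by auto
  qed
qed

lemma cas_hd_last: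
  assumes "pre_digraph.cas G u p v" "p \<noteq> []"
  shows "tail G (p ! 0) = u" "head G (p ! (length p - 1)) = v"
proof -
  interpret pre_digraph G .
  show "tail G (p ! 0) = u" using assms by (cases p) auto
  show "head G (p ! (length p - 1)) = v"
    using assms
  proof (induction p arbitrary: u)
    case (Cons a p)
    then show ?case by (cases p) auto
  qed simp
qed

text \<open>The list \<open>tl (awalk_verts u p)\<close> consists of the heads of the arcs, so its
  distinctness is injectivity of heads. Indices modulo the length remove the dependence on the
  starting point.\<close>

lemma cycle_nth:
  assumes "pre_digraph.cycle G p"
  shows "i < length p \<Longrightarrow> head G (p ! i) = tail G (p ! (Suc i mod length p))"
    and "i < length p \<Longrightarrow> j < length p \<Longrightarrow> head G (p ! i) = head G (p ! j) \<Longrightarrow> i = j"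
    and "set p \<subseteq> arcs G" and "p \<noteq> []"
proof -
  interpret pre_digraph G .
  obtain u where u: "cas u p u" "set p \<subseteq> arcs G" "p \<noteq> []" "distinct (tl (awalk_verts u p))"
    using assms by (auto simp: cycle_def awalk_def)
  have d: "distinct (map (head G) p)" using u(4) awalk_verts_conv'[OF u(1)] u(3) by simp
  show "head G (p ! i) = tail G (p ! (Suc i mod length p))" if "i < length p"
  proof (cases "Suc i < length p")
    case True
    then show ?thesis using cas_nth_Suc[OF u(1)] by simp
  next
    case False
    then have "Suc i = length p" using that by simp
    then show ?thesis using cas_hd_last[OF u(1,3)] by (metis diff_Suc_1 mod_self)
  qed
  show "i = j" if "i < length p" "j < length p" "head G (p ! i) = head G (p ! j)"
    using d that by (metis length_map nth_eq_iff_index_eq nth_map)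
  show "set p \<subseteq> arcs G" "p \<noteq> []" using u by auto
qed

text \<open>The leaf hangs on an arc and its reverse; the directed cycle of length 2 that they form
  is permitted. A longer cycle cannot visit the leaf, so it would already be a cycle of
  \<open>T\<close>.\<close>

lemma undirected_tree_add_leaf:
  assumes T: "undirected_tree T" "subgraph T G" and G: "graph G"
    and e: "e \<in> arcs G" "tail G e \<in> verts T" "head G e \<notin> verts T"
    and e': "e' \<in> arcs G" "tail G e' = head G e" "head G e' = tail G e"
  defines "T' \<equiv> \<lparr>verts = insert (head G e) (verts T), arcs = insert e (insert e' (arcs T)),
    tail = tail G, head = head G\<rparr>"
  shows "undirected_tree T'" "subgraph T' G"
proof -
  interpret G: graph G by fact
  interpret T: graph T using T(1) by (simp add: undirected_tree_def)
  have ht: "head T = head G" "tail T = tail G" and sub: "verts T \<subseteq> verts G" "arcs T \<subseteq> arcs G"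
    using T(2) by (auto simp: subgraph_def compatible_def)
  have inT: "head G a \<in> verts T" "tail G a \<in> verts T" if "a \<in> arcs T" for a
    using that T.head_in_verts T.tail_in_verts ht by auto
  have verts: "verts T' = insert (head G e) (verts T)" and arcs: "arcs T' = insert e (insert e' (arcs T))"
    and ht': "head T' = head G" "tail T' = tail G"
    by (auto simp: T'_def)
  have wf: "wf_digraph T'"
    by unfold_locales (use e e' inT in \<open>auto simp: verts arcs ht'\<close>)
  show sub': "subgraph T' G"
    using wf G.wf_digraph e(1) e'(1) sub G.head_in_verts[OF e(1)]
    by (auto simp: subgraph_def compatible_def verts arcs ht')
  have symT: "symmetric T'"
    unfolding symmetric_conv
  proof
    fix a assume "a \<in> arcs T'"
    then consider "a = e" | "a = e'" | "a \<in> arcs T" by (auto simp: arcs)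
    then show "\<exists>b\<in>arcs T'. tail T' a = head T' b \<and> head T' a = tail T' b"
    proof cases
      case 3
      then show ?thesis using T.sym_arcs unfolding symmetric_conv ht ht' arcs by blast
    qed (use e' in \<open>auto simp: arcs ht'\<close>)
  qed
  have gT': "graph T'"
  proof -
    interpret wf_digraph T' by fact
    show ?thesis
    proof unfold_locales
      show "finite (verts T')" "finite (arcs T')" by (auto simp: verts arcs)
      show "tail T' a \<noteq> head T' a" if "a \<in> arcs T'" for a
        using that G.no_loops[of a] sub(2) e(1) e'(1) by (auto simp: arcs ht')
      show "a = b" if "a \<in> arcs T'" "b \<in> arcs T'" "arc_to_ends T' a = arc_to_ends T' b" for a b
        using that G.no_multi_arcs[of a b] sub(2) e(1) e'(1) by (auto simp: arcs ht' arc_to_ends_def)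
    qed (rule symT)
  qed
  have conn: "connected T'"
  proof -
    interpret T': graph T' by (rule gT')
    have scT: "strongly_connected T"
      using T.symmetric_connected_imp_strongly_connected T.sym_arcs T(1)
      by (simp add: undirected_tree_def)
    have TT': "subgraph T T'"
      using T.wf_digraph wf by (auto simp: subgraph_def compatible_def verts arcs ht ht')
    have reachT: "a \<rightarrow>\<^sup>*\<^bsub>T'\<^esub> b" if "a \<in> verts T" "b \<in> verts T" for a b
      using scT that T'.reachable_mono[OF _ TT'] unfolding strongly_connected_def by blast
    have "(tail G e, head G e) \<in> arcs_ends T'" "(head G e, tail G e) \<in> arcs_ends T'"
      using e' by (force simp: arcs_ends_conv arcs ht')+
    then have leaf: "tail G e \<rightarrow>\<^sup>*\<^bsub>T'\<^esub> head G e" "head G e \<rightarrow>\<^sup>*\<^bsub>T'\<^esub> tail G e"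
      by (auto intro: T'.reachable_adjI)
    have to: "a \<rightarrow>\<^sup>*\<^bsub>T'\<^esub> tail G e" "tail G e \<rightarrow>\<^sup>*\<^bsub>T'\<^esub> a" if "a \<in> verts T'" for a
      using that reachT leaf e(2) by (auto simp: verts)
    have "(a, b) \<in> rtrancl_on (verts T') ((arcs_ends T')\<^sup>s)" if "a \<in> verts T'" "b \<in> verts T'" for a b
    proof -
      have "a \<rightarrow>\<^sup>*\<^bsub>T'\<^esub> b" using to that T'.reachable_trans by blast
      then show ?thesis unfolding reachable_def
        by (rule rtrancl_on_mono[rotated 2]) (auto simp: symcl_def)
    qed
    then show ?thesis unfolding connected_conv by (auto simp: verts)
  qed
  have "\<not> pre_digraph.cycle T' p" if len: "3 \<le> length p" for p
  proof
    assume cyc: "pre_digraph.cycle T' p"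
    let ?k = "length p"
    note nxt = cycle_nth(1)[OF cyc, unfolded ht'] and inj = cycle_nth(2)[OF cyc, unfolded ht']
      and arcs_p = cycle_nth(3)[OF cyc, unfolded arcs]
    have only: "a = e'" if "a \<in> set p" "tail G a = head G e" for a
      using that arcs_p inT(2)[of a] e(2,3) by auto
    have only': "a = e" if "a \<in> set p" "head G a = head G e" for a
      using that arcs_p inT(1)[of a] e(2,3) e'(3) by auto
    \<comment> \<open>The only arc into the leaf is \<open>e\<close> and the only arc out of it is \<open>e'\<close>, so a cycle through the
      leaf is \<open>e, e'\<close> and has length 2.\<close>
    have prev: "\<exists>j<?k. Suc j mod ?k = i \<and> (i = Suc j \<or> i = 0 \<and> Suc j = ?k)" if "i < ?k" for i
      by (cases i) (use that len in \<open>auto intro: exI[of _ "?k - 1"]\<close>)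
    \<comment> \<open>The arc before \<open>e\<close> and the arc \<open>e'\<close> after it both
      end in \<open>tail G e\<close>, so they have the same index. An index both one behind and one
      ahead of \<open>i\<close> contradicts length at least 3.\<close>
    have nomem: False if i: "i < ?k" "p ! i = e" for i
    proof -
      let ?s = "Suc i mod ?k"
      have s: "?s < ?k" using i(1) by (intro mod_less_divisor) linarith
      then have "p ! ?s = e'" using only[of "p ! ?s"] nxt[OF i(1)] i(2) by simp
      then have s_head: "head G (p ! ?s) = tail G (p ! i)" using e'(3) i(2) by simp
      obtain j where j: "j < ?k" "Suc j mod ?k = i" "i = Suc j \<or> i = 0 \<and> Suc j = ?k"
        using prev[OF i(1)] by (elim exE conjE) (rule that)
      have "head G (p ! j) = tail G (p ! i)" using nxt[OF j(1)] unfolding j(2) .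
      then have "j = ?s" using s_head by (intro inj[OF j(1) s]) (simp only:)
      moreover have "?s = Suc i \<or> Suc i = ?k \<and> ?s = 0"
        using i(1) by (cases "Suc i = ?k") simp_all
      ultimately show False using j(3) i(1) len by linarith
    qed
    have no_e: "e \<notin> set p" using nomem by (metis in_set_conv_nth)
    have no_e': "e' \<notin> set p"
    proof
      assume "e' \<in> set p"
      then obtain i where i: "i < ?k" "p ! i = e'" by (metis in_set_conv_nth)
      obtain j where j: "j < ?k" "Suc j mod ?k = i"
        using prev[OF i(1)] by (elim exE conjE) (rule that)
      then have "head G (p ! j) = head G e" using nxt[OF j(1)] i(2) e'(2) unfolding j(2) by simp
      then have "p ! j = e" using only' j(1) by simp
      then show False using nomem j(1) by blast
    qed
    have pT: "set p \<subseteq> arcs T" using arcs_p no_e no_e' by auto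
    have "pre_digraph.cycle T p"
    proof -
      obtain u where u: "pre_digraph.awalk T' u p u" "distinct (tl (pre_digraph.awalk_verts T' u p))" "p \<noteq> []"
        using cyc by (auto simp: pre_digraph.cycle_def)
      \<comment> \<open>Walks are read off from \<open>tail\<close> and \<open>head\<close>, on
        which \<open>T\<close> and \<open>T'\<close> agree.\<close>
      have c: "pre_digraph.cas T' a q b = pre_digraph.cas T a q b" for a q b
        by (induction q arbitrary: a) (simp_all add: pre_digraph.cas.simps ht ht')
      have cu: "pre_digraph.cas T u p u" using u(1) c by (simp add: pre_digraph.awalk_def)
      have "pre_digraph.awalk_verts T' u p = pre_digraph.awalk_verts T u p"
        by (simp add: pre_digraph.awalk_verts_conv ht ht')
      moreover have "u \<in> verts T"
        using cas_hd_last(1)[OF cu u(3)] pT u(3) T.tail_in_verts by (metis length_greater_0_conv nth_mem subsetD)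
      ultimately show ?thesis
        unfolding pre_digraph.cycle_def pre_digraph.awalk_def using u cu pT by auto
    qed
    then show False using T(1) len by (auto simp: undirected_tree_def)
  qed
  then show "undirected_tree T'" using gT' conn by (auto simp: undirected_tree_def)
qed

definition colour_adj :: "('a,'b) pre_digraph \<Rightarrow> ('a set \<Rightarrow> nat) \<Rightarrow> nat \<Rightarrow> 'a \<Rightarrow> 'a \<Rightarrow> bool" where
  "colour_adj G c i u v \<longleftrightarrow> (\<exists>e\<in>arcs G. tail G e = u \<and> head G e = v) \<and> c {u, v} = i"

text \<open>The tree is built along the derivation of \<open>grown\<close>. An arc and its reverse
  have the same unordered pair of ends, hence the same colour.\<close>

lemma grown_monochromatic_tree:
  assumes G: "graph G" and S: "grown (colour_adj G c i) S" "S \<subseteq> verts G"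
  shows "\<exists>T. monochromatic_tree G c T \<and> verts T = S"
proof -
  interpret G: graph G by fact
  have "\<exists>T. undirected_tree T \<and> subgraph T G \<and> (\<forall>e\<in>edges T. c e = i) \<and> verts T = S"
    using S
  proof (induction rule: grown.induct)
    case (single v)
    then show ?case
      using single_vertex_monochromatic_tree[OF G, of v c]
      by (intro exI[of _ "\<lparr>verts = {v}, arcs = {}, tail = tail G, head = head G\<rparr>"])
        (auto simp: monochromatic_tree_def edges_def)
  next
    case (leaf S u v)
    then obtain T where T: "undirected_tree T" "subgraph T G" "\<forall>e\<in>edges T. c e = i" "verts T = S"
      by auto
    obtain e where e: "e \<in> arcs G" "tail G e = u" "head G e = v" "c {u, v} = i"
      using leaf.hyps by (auto simp: colour_adj_def)
    obtain e' where e': "e' \<in> arcs G" "tail G e' = v" "head G e' = u"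
      using G.sym_arcs e unfolding symmetric_conv by metis
    let ?T = "\<lparr>verts = insert (head G e) (verts T), arcs = insert e (insert e' (arcs T)),
      tail = tail G, head = head G\<rparr>"
    have ht: "head T = head G" "tail T = tail G" using T(2) by (auto simp: subgraph_def compatible_def)
    have "undirected_tree ?T" "subgraph ?T G"
      using undirected_tree_add_leaf[OF T(1,2) G e(1) _ _ e'(1)] e e' leaf.hyps T(4) by auto
    moreover have "\<forall>e\<in>edges ?T. c e = i"
      using T(3) e e' ht by (auto simp: edges_def arc_edge_def insert_commute)
    moreover have "verts ?T = insert v S" using e T(4) by simp
    ultimately show ?case by blast
  qed
  then show ?thesis by (auto simp: monochromatic_tree_def)
qed

section \<open>Choice of the splitting size and passage from degrees to missing edges\<close>

lemma splitting_size_large: "\<exists>n0::nat. \<forall>n\<ge>n0. 24 * n * 2 ^ (n div 512) < (3::nat) ^ (n div 512)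
    \<and> 256 * (n div 512) + 256 \<le> n"
proof -
  \<comment> \<open>With m = \<open>n div 512\<close>, the bound n \<le> 512 m + 512 reduces the
    exponential inequality to one in m alone. The divisor is twice 256, which leaves n/2 for the
    summand 256.\<close>
  have "eventually (\<lambda>m::nat. 24 * (512 * real m + 512) * 2 ^ m < (3::real) ^ m) at_top"
    by real_asymp
  then obtain m0 where m0: "\<And>m. m \<ge> m0 \<Longrightarrow> 24 * (512 * real m + 512) * 2 ^ m < (3::real) ^ m"
    unfolding eventually_at_top_linorder by blast
  have "24 * n * 2 ^ (n div 512) < (3::nat) ^ (n div 512) \<and> 256 * (n div 512) + 256 \<le> n"
    if n: "512 * m0 + 512 \<le> n" for n
  proof
    let ?m = "n div 512"
    have m: "m0 \<le> ?m" using n by linarith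
    have "n \<le> 512 * ?m + 512" by linarith
    then have "real n \<le> real (512 * ?m + 512)" by (rule of_nat_mono)
    then have "24 * real n * 2 ^ ?m \<le> 24 * (512 * real ?m + 512) * 2 ^ ?m"
      by (intro mult_mono) auto
    also have "\<dots> < 3 ^ ?m" using m0[OF m] .
    finally have "real (24 * n * 2 ^ ?m) < real (3 ^ ?m)" by simp
    then show "24 * n * 2 ^ ?m < 3 ^ ?m" by (simp only: of_nat_less_iff)
    show "256 * ?m + 256 \<le> n" using n by linarith
  qed
  then show ?thesis by blast
qed

lemma out_degree_le_card_neighbours:
  assumes "graph G" and "\<And>e. e \<in> arcs G \<Longrightarrow> tail G e = u \<Longrightarrow> head G e \<in> W" and "finite W"
  shows "out_degree G u + card {w\<in>W. (u, w) \<notin> arcs_ends G} \<le> card W"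
proof -
  interpret graph G by fact
  let ?N = "{w\<in>W. (u, w) \<in> arcs_ends G}" and ?M = "{w\<in>W. (u, w) \<notin> arcs_ends G}"
  have "inj_on (head G) (out_arcs G u)"
    by (rule inj_onI) (auto simp: out_arcs_def arc_to_ends_def intro: no_multi_arcs)
  then have "out_degree G u = card (head G ` out_arcs G u)"
    by (simp add: out_degree_def card_image)
  also have "\<dots> \<le> card ?N"
    by (rule card_mono) (use assms in \<open>auto simp: out_arcs_def arcs_ends_conv\<close>)
  finally have "out_degree G u + card ?M \<le> card ?N + card ?M" by simp
  also have "\<dots> = card (?N \<union> ?M)" by (rule card_Un_disjoint[symmetric]) (use assms(3) in auto)
  also have "?N \<union> ?M = W" by auto
  finally show ?thesis .
qed

lemma colour_adj_cases:
  assumes "graph G" "edge_colouring 2 G c"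
  shows "colour_adj G c 0 u v \<or> colour_adj G c 1 u v \<longleftrightarrow> (u, v) \<in> arcs_ends G"
proof
  assume "(u, v) \<in> arcs_ends G"
  then obtain e where e: "e \<in> arcs G" "tail G e = u" "head G e = v" by auto
  then have "c {u, v} \<in> c ` edges G" by (auto simp: edges_def arc_edge_def)
  then have "c {u, v} < 2" using assms(2) by (auto simp: edge_colouring_def)
  then have "c {u, v} = 0 \<or> c {u, v} = 1" by linarith
  then show "colour_adj G c 0 u v \<or> colour_adj G c 1 u v"
    using e unfolding colour_adj_def by blast
qed (auto simp: colour_adj_def arcs_ends_conv)

lemma symp_colour_adj:
  assumes "graph G"
  shows "symp (colour_adj G c i)"
proof (rule sympI)
  interpret graph G by fact
  fix u v assume "colour_adj G c i u v"
  then obtain e where e: "e \<in> arcs G" "tail G e = u" "head G e = v" and c: "c {u, v} = i"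
    by (auto simp: colour_adj_def)
  obtain e' where "e' \<in> arcs G" "tail G e' = v" "head G e' = u"
    using sym_arcs e unfolding symmetric_conv by metis
  then show "colour_adj G c i v u" using c unfolding colour_adj_def by (auto simp: insert_commute)
qed

lemma tp_le_3:
  assumes n: "24 * n * 2 ^ (n div 512) < (3::nat) ^ (n div 512)" "256 * (n div 512) + 256 \<le> n"
    and K: "complete_bipartite_digraph n n K" and G: "graph G" and GK: "spanning G K"
    and deg: "13 * n \<le> 16 * min_degree G"
  shows "tp 2 G \<le> 3"
proof -
  interpret G: graph G by fact
  obtain U W where UW: "verts K = U \<union> W" "U \<inter> W = {}" "card U = n" "card W = n"
      and ends: "arcs_ends K = U \<times> W \<union> W \<times> U"
    using K unfolding complete_bipartite_digraph_def by blast
  have "n > 0" using n(2) by linarith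
  then have fin: "finite U" "finite W" using UW card.infinite by fastforce+
  have V: "verts G = U \<union> W" using GK UW by (simp add: spanning_def)
  have sides: "u \<in> U \<and> v \<in> W \<or> u \<in> W \<and> v \<in> U" if "(u, v) \<in> arcs_ends G" for u v
  proof -
    have "(u, v) \<in> arcs_ends K"
      using GK that by (auto simp: spanning_def subgraph_def compatible_def arcs_ends_conv)
    then show ?thesis using ends by auto
  qed
  have min_deg: "min_degree G \<le> out_degree G u" if "u \<in> U \<union> W" for u
    unfolding min_degree_def using that V G.finite_verts by (intro Min_le finite_imageI) auto
  \<comment> \<open>Out-degree at least 13n/16 leaves at most 3n/16 non-neighbours. The sides are
    kept generic so that the bound serves both.\<close>
  have missing: "16 * card {w\<in>Y. (u, w) \<notin> arcs_ends G} \<le> 3 * n"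
    if "u \<in> X" "X \<subseteq> U \<union> W" "finite Y" "card Y = n"
      "\<And>v. (u, v) \<in> arcs_ends G \<Longrightarrow> v \<in> Y" for u X Y
  proof -
    have "out_degree G u + card {w\<in>Y. (u, w) \<notin> arcs_ends G} \<le> card Y"
      by (rule out_degree_le_card_neighbours[OF G _ that(3)])
        (use that(5) in \<open>auto simp: arcs_ends_conv\<close>)
    then show ?thesis using min_deg[of u] that deg by auto
  qed
  show ?thesis
    unfolding tp_le_iff[OF G]
  proof (intro allI impI)
    fix c :: "'a set \<Rightarrow> nat" assume c: "edge_colouring 2 G c"
    note adj = colour_adj_cases[OF G c]
    interpret two_coloured_bipartite U W "colour_adj G c 0" "colour_adj G c 1" n "n div 512"
    proof
      show "colour_adj G c 0 u v \<or> colour_adj G c 1 u v \<Longrightarrow> u \<in> U \<and> v \<in> W \<or> u \<in> W \<and> v \<in> U" for u v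
        using adj sides by blast
      show "\<not> (colour_adj G c 0 u v \<and> colour_adj G c 1 u v)" for u v
        by (auto simp: colour_adj_def)
      show "16 * card {w\<in>W. \<not> colour_adj G c 0 u w \<and> \<not> colour_adj G c 1 u w} \<le> 3 * n"
        if "u \<in> U" for u
        using missing[of u U W] that sides UW(2,4) fin adj by (auto simp flip: de_Morgan_disj)
      show "16 * card {u\<in>U. \<not> colour_adj G c 0 w u \<and> \<not> colour_adj G c 1 w u} \<le> 3 * n"
        if "w \<in> W" for w
        using missing[of w W U] that sides UW(2,3) fin adj by (auto simp flip: de_Morgan_disj)
    qed (use n UW fin symp_colour_adj[OF G] in auto)
    obtain P where P: "partition_on (U \<union> W) P" "finite P" "card P \<le> 3"
      "\<And>X. X \<in> P \<Longrightarrow> grown (colour_adj G c 0) X \<or> grown (colour_adj G c 1) X"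
      using three_parts_exist unfolding three_parts_def by blast
    have "X \<subseteq> verts G" if "X \<in> P" for X using P(1) that V by (auto simp: partition_on_def)
    then have tree: "\<exists>T. monochromatic_tree G c T \<and> verts T = X" if "X \<in> P" for X
      using P(4)[OF that] that by (elim disjE) (rule grown_monochromatic_tree[OF G]; simp)+
    show "\<exists>P. mono_tree_partition G c P \<and> finite P \<and> card P \<le> 3"
      unfolding mono_tree_partition_def V using P(1-3) tree by (intro exI[of _ P]) simp
  qed
qed

theorem theorem1p8:
  fixes \<delta> :: real
  assumes "\<delta> > 0"
  shows "\<exists>n0::nat. \<forall>n\<ge>n0. \<forall>(K :: ('a,'b) pre_digraph) (G :: ('a,'b) pre_digraph).
    complete_bipartite_digraph n n K \<and> graph G \<and> spanning G K \<and>
    real (min_degree G) \<ge> (13 / 16 + \<delta>) * real n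
      \<longrightarrow> tp 2 G \<le> 3"
proof -
  obtain n0 where n0: "\<And>n. n \<ge> n0 \<Longrightarrow> 24 * n * 2 ^ (n div 512) < (3::nat) ^ (n div 512)
      \<and> 256 * (n div 512) + 256 \<le> n"
    using splitting_size_large by blast
  have "13 * n \<le> 16 * d" if "(13 / 16 + \<delta>) * real n \<le> real d" for n d :: nat
  proof -
    have "0 \<le> \<delta> * real n" using assms by simp
    then have "real (13 * n) \<le> real (16 * d)" using that by (simp add: distrib_right)
    then show ?thesis by (simp only: of_nat_le_iff)
  qed
  then show ?thesis using n0 tp_le_3 by blast
qed

end
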